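(* Let $u_F>0$, $U_F=(-u_F,u_F)^n$, and let $F: \mathbb{R}^m \to U_F$ be a continuous semialgebraic function. Then there exist $\mathcal{N} \in ISDnet(m,n,1)$ and $c_{\max} > 0$ such that $\mathrm{SANN}^{lim}(\mathcal{N}, x, c_{\max}) = F(x)$ for all $x\in\mathbb{R}^m$.
   Context: For $D \subseteq \mathbb{R}^N$, $ISD(D)$ is the smallest set of functions $D \to \mathbb{R}$ containing all restrictions of real polynomials and closed under pointwise $\min$ and $\max$; vector/matrix-valued functions are ISD if all entries are. $ISDnet(m,n,k) := ISD(\mathbb{R}^m\times\mathbb{R}^{n+k}\times\mathbb{R},\ \mathbb{R}^{(n+k)\times(n+k)}\times\mathbb{R}^{n+k})$; for $\mathcal N$ in it write $\mathcal N(x,z,s) = (M(x,z,s), b(x,z,s))$. For $c>0$, $\mathrm{clamp\text{-}sol}_c(M,b) := \mathrm{clamp}(M^{-1}b,-c,c)$ if $M$ is invertible and $0$ otherwise, where $\mathrm{clamp}(a,-c,c)$ replaces each component $a_i$ by $\min(\max(a_i,-c),c)$. The limit SANN $\mathrm{SANN}^{lim}(\mathcal N,x,c_{\max})$ is the vector of the first $n$ components of $z(1)$, where $z:[0,1]\to\mathbb{R}^{n+k}$ is the (exact) solution of $\dot z(s) = \mathrm{clamp\text{-}sol}_{c_{\max}}(M(x,z(s),s), b(x,z(s),s))$, $z(0)=0$. A semialgebraic function is one whose graph is a semialgebraic set. *)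

theory Defs
  imports "HOL-Analysis.Analysis"
begin

inductive poly_fun :: "('a::euclidean_space \<Rightarrow> real) \<Rightarrow> bool" where
  pf_const: "poly_fun (\<lambda>y. c)"
| pf_coord: "b \<in> Basis \<Longrightarrow> poly_fun (\<lambda>y. y \<bullet> b)"
| pf_add: "poly_fun p \<Longrightarrow> poly_fun q \<Longrightarrow> poly_fun (\<lambda>y. p y + q y)"
| pf_mult: "poly_fun p \<Longrightarrow> poly_fun q \<Longrightarrow> poly_fun (\<lambda>y. p y * q y)"

inductive semialgebraic :: "'a::euclidean_space set \<Rightarrow> bool" where
  sa_pos: "poly_fun p \<Longrightarrow> semialgebraic {y. 0 < p y}"
| sa_zero: "poly_fun p \<Longrightarrow> semialgebraic {y. p y = 0}"
| sa_compl: "semialgebraic A \<Longrightarrow> semialgebraic (- A)"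
| sa_union: "semialgebraic A \<Longrightarrow> semialgebraic B \<Longrightarrow> semialgebraic (A \<union> B)"

definition semialgebraic_fun :: "('a::euclidean_space \<Rightarrow> 'b::euclidean_space) \<Rightarrow> bool" where
  "semialgebraic_fun F \<longleftrightarrow> semialgebraic {(x, F x) | x. True}"

text \<open>ISD functions on the whole space (domain D = whole space, so restriction is trivial).\<close>
inductive isd :: "('a::euclidean_space \<Rightarrow> real) \<Rightarrow> bool" where
  isd_poly: "poly_fun p \<Longrightarrow> isd p"
| isd_min: "isd f \<Longrightarrow> isd g \<Longrightarrow> isd (\<lambda>y. min (f y) (g y))"
| isd_max: "isd f \<Longrightarrow> isd g \<Longrightarrow> isd (\<lambda>y. max (f y) (g y))"

text \<open>ISDnet(m,n,k): the index types 'm, 'n, 'k have cardinalities m, n, k;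
  the state space R^(n+k) is indexed by 'n + 'k (Inl = first n components).\<close>
definition isd_net ::
  "(real^'m::finite \<Rightarrow> real^('n::finite + 'k::finite) \<Rightarrow> real \<Rightarrow> real^('n + 'k)^('n + 'k)) \<Rightarrow>
   (real^'m \<Rightarrow> real^('n + 'k) \<Rightarrow> real \<Rightarrow> real^('n + 'k)) \<Rightarrow> bool" where
  "isd_net M b \<longleftrightarrow>
     (\<forall>i j. isd (\<lambda>(x, z, s). M x z s $ i $ j)) \<and> (\<forall>i. isd (\<lambda>(x, z, s). b x z s $ i))"

definition clamp :: "real \<Rightarrow> real^'d \<Rightarrow> real^'d" where
  "clamp c a = (\<chi> i. min (max (a $ i) (- c)) c)"

definition clamp_sol :: "real \<Rightarrow> real^'d^'d \<Rightarrow> real^'d \<Rightarrow> real^'d" where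
  "clamp_sol c M b = (if invertible M then clamp c (matrix_inv M *v b) else 0)"

definition sann_solution ::
  "(real^'m \<Rightarrow> real^'d \<Rightarrow> real \<Rightarrow> real^'d^'d) \<Rightarrow> (real^'m \<Rightarrow> real^'d \<Rightarrow> real \<Rightarrow> real^'d) \<Rightarrow>
   real^'m \<Rightarrow> real \<Rightarrow> (real \<Rightarrow> real^'d) \<Rightarrow> bool" where
  "sann_solution M b x c z \<longleftrightarrow> z 0 = 0 \<and>
     (\<forall>s\<in>{0..1}. (z has_vector_derivative clamp_sol c (M x (z s) s) (b x (z s) s)) (at s within {0..1}))"

definition first_comps :: "real^('n::finite + 'k::finite) \<Rightarrow> real^'n" where
  "first_comps v = (\<chi> i. v $ Inl i)"

end

theory Submission
  imports Defs
begin

text \<open>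
  Semialgebraic sets are closed under projection, so for each component the sets below and above
  the graph of \<open>F\<^sub>i\<close> are open and semialgebraic. By the Lojasiewicz inequality an open semialgebraic
  set is the positivity set of an ISD function; subtracting the two functions and
  applying the inequality once more yields an ISD function \<open>H\<^sub>i (x, y)\<close> with the sign of
  \<open>F\<^sub>i x - y\<close> and \<open>\<bar>F\<^sub>i x - y\<bar> ^ N \<le> \<bar>H\<^sub>i (x, y)\<bar>\<close>, uniformly in \<open>x\<close>. The net is decoupled:
  \<open>z\<^sub>i' = clamp (K * H\<^sub>i (x, z\<^sub>i) / (1 - s) ^ (2 * N))\<close>, i.e. \<open>M\<close> is diagonal and becomes singular
  at \<open>s = 1\<close>. For suitable \<open>K\<close> and \<open>c\<close> the parabola \<open>u * (1 - s)\<^sup>2\<close> is a barrier for the error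
  \<open>\<bar>z\<^sub>i - F\<^sub>i x\<bar>\<close>, which forces \<open>z\<^sub>i = F\<^sub>i x\<close> with velocity \<open>0\<close> at \<open>s = 1\<close>. The additional state
  component is constantly \<open>0\<close>.
\<close>

section \<open>Increasing bijections matching sign diagrams\<close>

text \<open>An autonomous Lipschitz field cannot reach its equilibrium \<open>F x\<close> in finite
  time, so the gain must blow up at \<open>s = 1\<close>; dividing by a vanishing quantity makes
  \<open>M\<close> singular, and there \<open>clamp_sol\<close> is \<open>0\<close>. The solution
  therefore has to arrive with velocity \<open>0\<close>, which is why the barrier is quadratic: its
  difference quotient at \<open>1\<close> tends to \<open>0\<close>. At contact with it, the
  Lojasiewicz bound gives \<open>\<bar>H\<bar> \<ge> u ^ N * (1 - s) ^ (2 * N)\<close>, whence the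
  exponent \<open>2 * N\<close> in the denominator and \<open>K = c / u ^ N\<close>; the barrier
  moves with speed at most \<open>2 * u\<close>, whence \<open>c = 2 * u + 1\<close>. As
  \<open>x\<close> is unbounded, a single exponent for all \<open>x\<close> calls for a Lojasiewicz
  inequality with a weight that grows polynomially; the weight is multiplied into \<open>H\<close>,
  which stays ISD because nonnegative polynomial factors commute with min and max. The barrier
  catches every solution at once. Existence is a separate matter, settled by a time change that
  sends \<open>s = 1\<close> to infinity.\<close>

lemma poly_sgn_const:
  fixes r :: "real poly"
  assumes "a \<le> b" "\<And>t. a \<le> t \<Longrightarrow> t \<le> b \<Longrightarrow> poly r t \<noteq> 0"
  shows "sgn (poly r a) = sgn (poly r b)"
proof (rule ccontr)
  assume ne: "sgn (poly r a) \<noteq> sgn (poly r b)"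
  then have "a < b" using assms(1) by (cases "a = b") auto
  moreover have "poly r a \<noteq> 0" "poly r b \<noteq> 0" using assms by auto
  then have "poly r a * poly r b < 0"
    using ne by (auto simp: sgn_if mult_less_0_iff split: if_splits)
  ultimately show False using poly_IVT[of a b r] assms(2) by force
qed

lemma poly_unbounded_at_top:
  fixes q :: "real poly"
  assumes "degree q > 0"
  shows "\<exists>y\<ge>B. \<bar>poly q y\<bar> > C"
proof -
  have "filterlim (poly q) at_infinity at_top"
    using filterlim_poly_at_infinity[OF assms] filterlim_mono at_top_le_at_infinity by blast
  then have "eventually (\<lambda>y. \<bar>poly q y\<bar> > C) at_top"
    unfolding filterlim_at_infinity_conv_norm_at_top
    by (auto simp: filterlim_at_top_dense)
  then obtain N where N: "\<And>y. y \<ge> N \<Longrightarrow> \<bar>poly q y\<bar> > C"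
    unfolding eventually_at_top_linorder by blast
  then show ?thesis by (intro exI[of _ "max N B"]) auto
qed

lemma poly_unbounded_at_bot:
  fixes q :: "real poly"
  assumes "degree q > 0"
  shows "\<exists>y\<le>B. \<bar>poly q y\<bar> > C"
proof -
  have "filterlim (poly q) at_infinity at_bot"
    using filterlim_poly_at_infinity[OF assms] filterlim_mono at_bot_le_at_infinity by blast
  then have "eventually (\<lambda>y. \<bar>poly q y\<bar> > C) at_bot"
    unfolding filterlim_at_infinity_conv_norm_at_top
    by (auto simp: filterlim_at_top_dense)
  then obtain N where N: "\<And>y. y \<le> N \<Longrightarrow> \<bar>poly q y\<bar> > C"
    unfolding eventually_at_bot_linorder by blast
  then show ?thesis by (intro exI[of _ "min N B"]) auto
qed

lemma strict_mono_affine: "(0::real) < k \<Longrightarrow> strict_mono (\<lambda>t. k * t + m)"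
  by (simp add: strict_mono_def)

lemma strict_mono_max: "strict_mono f \<Longrightarrow> strict_mono g \<Longrightarrow> strict_mono (\<lambda>t. max (f t) (g t))"
  for f g :: "real \<Rightarrow> real"
  unfolding strict_mono_def less_max_iff_disj max_less_iff_conj by (metis linorder_le_cases order_less_le_trans)

lemma strict_mono_min: "strict_mono f \<Longrightarrow> strict_mono g \<Longrightarrow> strict_mono (\<lambda>t. min (f t) (g t))"
  for f g :: "real \<Rightarrow> real"
  unfolding strict_mono_def min_less_iff_disj min_less_iff_conj by (metis linorder_le_cases order_le_less_trans)

lemma ex_increasing_bij_moving_up:
  fixes a u v b :: real
  assumes "a < u" "u \<le> v" "v < b"
  shows "\<exists>\<alpha>. strict_mono \<alpha> \<and> surj \<alpha> \<and> \<alpha> u = v \<and> (\<forall>t. t \<le> a \<or> b \<le> t \<longrightarrow> \<alpha> t = t)"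
proof -
  define k1 where "k1 = (v - a) / (u - a)"
  define k2 where "k2 = (b - v) / (b - u)"
  \<comment> \<open>The two lines join \<open>(a, a)\<close> to \<open>(u, v)\<close> and
    \<open>(u, v)\<close> to \<open>(b, b)\<close>. Their minimum is a tent that lies above the
    diagonal at most between \<open>a\<close> and \<open>b\<close>.\<close>
  define \<alpha> where "\<alpha> t = max t (min (k1 * t + (a - k1 * a)) (k2 * t + (b - k2 * b)))" for t
  have k: "1 \<le> k1" "0 < k2" "k2 \<le> 1"
    using assms by (auto simp: k1_def k2_def field_simps)
  have "strict_mono \<alpha>"
    unfolding \<alpha>_def using k
    by (intro strict_mono_max strict_mono_min strict_mono_affine) (auto simp: strict_mono_def)
  moreover have id: "\<alpha> t = t" if "t \<le> a \<or> b \<le> t" for t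
  proof -
    have "k1 * t + (a - k1 * a) \<le> t" if "t \<le> a"
      using mult_nonneg_nonpos[of "k1 - 1" "t - a"] that k by (simp add: algebra_simps)
    moreover have "k2 * t + (b - k2 * b) \<le> t" if "b \<le> t"
      using mult_nonneg_nonneg[of "1 - k2" "t - b"] that k by (simp add: algebra_simps)
    ultimately show ?thesis using that unfolding \<alpha>_def by auto
  qed
  moreover have "\<alpha> u = v"
  proof -
    have "k1 * (u - a) = v - a" "k2 * (b - u) = b - v"
      using assms by (auto simp: k1_def k2_def)
    then have "k1 * u + (a - k1 * a) = v" "k2 * u + (b - k2 * b) = v"
      by (simp_all add: algebra_simps)
    then show ?thesis using assms unfolding \<alpha>_def by auto
  qed
  moreover have "surj \<alpha>"
  proof -
    have cont: "continuous_on {a..b} \<alpha>"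
      unfolding \<alpha>_def by (intro continuous_intros)
    have "\<exists>t. \<alpha> t = y" for y
    proof (cases "y \<le> a \<or> b \<le> y")
      case False
      then show ?thesis using IVT'[of \<alpha> a y b] id[of a] id[of b] cont assms by auto
    qed (use id in blast)
    then show ?thesis by (metis surjI)
  qed
  ultimately show ?thesis by blast
qed

lemma strict_mono_inv_surj:
  fixes f :: "real \<Rightarrow> real"
  assumes "strict_mono f" "surj f"
  shows "strict_mono (inv f)" "surj (inv f)"
  using assms strict_mono_inv[of f "inv f"]
  by (auto simp: surj_f_inv_f strict_mono_imp_inj_on inj_imp_surj_inv)

lemma ex_increasing_bij_moving:
  fixes a u v b :: real
  assumes "a < u" "u < b" "a < v" "v < b"
  shows "\<exists>\<alpha>. strict_mono \<alpha> \<and> surj \<alpha> \<and> \<alpha> u = v \<and> (\<forall>t. t \<le> a \<or> b \<le> t \<longrightarrow> \<alpha> t = t)"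
proof (cases "u \<le> v")
  case True
  then show ?thesis using ex_increasing_bij_moving_up assms by blast
next
  case False
  then obtain \<alpha> where \<alpha>: "strict_mono \<alpha>" "surj \<alpha>" "\<alpha> v = u"
      "\<forall>t. t \<le> a \<or> b \<le> t \<longrightarrow> \<alpha> t = t"
    using ex_increasing_bij_moving_up[of a v u b] assms by auto
  have "inj \<alpha>" using \<alpha>(1) strict_mono_imp_inj_on by blast
  then have "inv \<alpha> u = v" "\<forall>t. t \<le> a \<or> b \<le> t \<longrightarrow> inv \<alpha> t = t"
    using \<alpha>(3,4) by (auto intro: inv_f_eq)
  then show ?thesis using strict_mono_inv_surj[OF \<alpha>(1,2)] by blast
qed

text \<open>
  The sign diagram of finitely many univariate polynomials is compared by an increasing bijection
  \<open>\<phi>\<close> of the line instead of by sign tables: \<open>\<phi>\<close> matches the diagrams if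
  \<open>r\<close> at \<open>t\<close> and its partner \<open>r'\<close> at \<open>\<phi> t\<close> always have the
  same sign. If the pair of derivatives is matched and \<open>p\<close>, \<open>q\<close> agree in sign at the
  roots \<open>Z\<close> of the matched polynomials, then \<open>p\<close> and \<open>q\<close> are monotone and have
  corresponding roots between consecutive points of \<open>Z\<close>, and moving these roots onto each other
  inside the gaps makes \<open>\<phi>\<close> match \<open>p\<close> with \<open>q\<close> as well.
\<close>

locale sign_diagram =
  fixes \<phi> :: "real \<Rightarrow> real" and R :: "(real poly \<times> real poly) set" and p q :: "real poly"
  assumes mono: "strict_mono \<phi>" and onto: "surj \<phi>" and fin: "finite R"
    and sgn_match: "(r, r') \<in> R \<Longrightarrow> sgn (poly r t) = sgn (poly r' (\<phi> t))"
    and deriv_mem: "(pderiv p, pderiv q) \<in> R" and deriv_nz: "pderiv p \<noteq> 0"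
    and sgn_crit: "(r, r') \<in> R \<Longrightarrow> r \<noteq> 0 \<Longrightarrow> poly r t = 0 \<Longrightarrow> sgn (poly p t) = sgn (poly q (\<phi> t))"
begin

text \<open>These points cut the line into gaps on which \<open>p\<close> is strictly monotone, as
  \<open>pderiv p\<close> is among the \<open>r\<close>. Zero polynomials are left out to keep the
  set finite; they do occur in \<open>R\<close>, since all coefficients may vanish at a
  parameter.\<close>

definition Z :: "real set" where
  "Z = {t. \<exists>(r, r') \<in> R. r \<noteq> 0 \<and> poly r t = 0}"

lemma phi_inv [simp]: "\<phi> (inv \<phi> t) = t"
  using onto surj_f_inv_f by metis

lemma inv_phi [simp]: "inv \<phi> (\<phi> t) = t"
  using mono strict_mono_imp_inj_on inv_f_f by metis

lemma less_iff [simp]: "\<phi> s < \<phi> t \<longleftrightarrow> s < t"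
  using mono strict_mono_less by blast

lemma le_iff [simp]: "\<phi> s \<le> \<phi> t \<longleftrightarrow> s \<le> t"
  using mono strict_mono_less_eq by blast

lemma zero_iff: "(r, r') \<in> R \<Longrightarrow> r = 0 \<longleftrightarrow> r' = 0"
proof -
  assume r: "(r, r') \<in> R"
  have "(\<forall>t. poly r t = 0) \<longleftrightarrow> (\<forall>t. poly r' (\<phi> t) = 0)"
    using sgn_match[OF r] by (metis sgn_0_0)
  also have "\<dots> \<longleftrightarrow> (\<forall>t. poly r' t = 0)"
    using onto by (metis surjD)
  finally show ?thesis by (simp only: poly_all_0_iff_0)
qed

text \<open>The hypotheses are symmetric under exchanging the two sides, so every fact about roots
  of \<open>p\<close> is available for roots of \<open>q\<close> as well, with
  \<open>inv \<phi>\<close> and \<open>R\<inverse>\<close>.\<close>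

lemma converse: "sign_diagram (inv \<phi>) (R\<inverse>) q p"
proof
  show "strict_mono (inv \<phi>)" "surj (inv \<phi>)"
    using strict_mono_inv_surj mono onto by blast+
  show "finite (R\<inverse>)" using fin by simp
  show "sgn (poly r t) = sgn (poly r' (inv \<phi> t))" if "(r, r') \<in> R\<inverse>" for r r' t
    using sgn_match[of r' r "inv \<phi> t"] that by simp
  show "(pderiv q, pderiv p) \<in> R\<inverse>" using deriv_mem by simp
  show "pderiv q \<noteq> 0" using deriv_mem deriv_nz zero_iff by blast
  show "sgn (poly q t) = sgn (poly p (inv \<phi> t))"
    if "(r, r') \<in> R\<inverse>" "r \<noteq> 0" "poly r t = 0" for r r' t
  proof -
    have "(r', r) \<in> R" using that by simp
    moreover have "r' \<noteq> 0" using zero_iff[OF \<open>(r', r) \<in> R\<close>] that by simp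
    moreover have "poly r' (inv \<phi> t) = 0"
      using sgn_match[OF \<open>(r', r) \<in> R\<close>, of "inv \<phi> t"] that by (simp add: sgn_eq_0_iff)
    ultimately show ?thesis using sgn_crit[of r' r "inv \<phi> t"] by simp
  qed
qed

lemma finite_Z: "finite Z"
proof -
  have "Z = (\<Union>(r, r') \<in> {x \<in> R. fst x \<noteq> 0}. {t. poly r t = 0})"
    unfolding Z_def by auto
  also have "finite \<dots>" using fin poly_roots_finite by (auto intro!: finite_UN_I)
  finally show ?thesis .
qed

lemma Z_converse: "\<phi> t \<in> sign_diagram.Z (R\<inverse>) \<longleftrightarrow> t \<in> Z"
proof -
  have "poly r t = 0 \<longleftrightarrow> poly r' (\<phi> t) = 0" if "(r, r') \<in> R" for r r'
    using sgn_match[OF that, of t] by (metis sgn_0_0)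
  then show ?thesis
    unfolding sign_diagram.Z_def[OF converse] Z_def using zero_iff by fastforce
qed

lemma deriv_root: "poly (pderiv p) t = 0 \<Longrightarrow> t \<in> Z"
  using deriv_mem deriv_nz unfolding Z_def by blast

lemma deriv_sgn_const:
  assumes "a \<le> b" "\<And>t. a \<le> t \<Longrightarrow> t \<le> b \<Longrightarrow> t \<notin> Z"
  shows "sgn (poly (pderiv p) a) = sgn (poly (pderiv p) b)"
  using poly_sgn_const[OF assms(1)] assms(2) deriv_root by blast

text \<open>The derivative keeps its sign inside a gap, so the mean value point may be traded for
  any interior \<open>c\<close>. Only the open interval has to avoid \<open>Z\<close>: the endpoints
  are often points of \<open>Z\<close> themselves.\<close>

lemma MVT_sgn:
  assumes "a < b" "\<And>t. a < t \<Longrightarrow> t < b \<Longrightarrow> t \<notin> Z" "c \<in> {a<..<b}"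
  shows "\<exists>e>0. poly p b - poly p a = e * sgn (poly (pderiv p) c)"
proof -
  obtain \<xi> where \<xi>: "a < \<xi>" "\<xi> < b" "poly p b - poly p a = (b - a) * poly (pderiv p) \<xi>"
    using poly_MVT[OF assms(1)] by blast
  have "sgn (poly (pderiv p) (min c \<xi>)) = sgn (poly (pderiv p) (max c \<xi>))"
    using assms \<xi> by (intro deriv_sgn_const) auto
  then have s: "sgn (poly (pderiv p) c) = sgn (poly (pderiv p) \<xi>)"
    by (auto simp: min_def max_def split: if_splits)
  have "poly (pderiv p) \<xi> \<noteq> 0" using deriv_root assms \<xi> by blast
  then show ?thesis
    using \<xi> assms(1) s by (intro exI[of _ "(b - a) * \<bar>poly (pderiv p) \<xi>\<bar>"])
      (simp add: mult_sgn_abs abs_mult_sgn mult.assoc)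
qed

lemma root_unique:
  assumes "poly p a = 0" "poly p b = 0" "\<And>t. t \<in> closed_segment a b \<Longrightarrow> t \<notin> Z"
  shows "a = b"
proof (rule ccontr)
  assume "a \<noteq> b"
  then obtain a' b' where ab: "a' < b'" "poly p a' = 0" "poly p b' = 0" "\<And>t. a' < t \<Longrightarrow> t < b' \<Longrightarrow> t \<notin> Z"
  proof (cases "a < b")
    case True
    then show thesis using that[of a b] assms by (auto simp: closed_segment_eq_real_ivl)
  next
    case False
    then show thesis using that[of b a] assms \<open>a \<noteq> b\<close> by (auto simp: closed_segment_eq_real_ivl)
  qed
  obtain t where "a' < t" "t < b'" "poly (pderiv p) t = 0"
    using poly_MVT[OF ab(1), of p] ab by auto
  then show False using ab deriv_root by blast
qed

lemma degree_pos: "degree p > 0"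
  using deriv_nz by (metis pderiv_eq_0_iff gr0I)

text \<open>If \<open>Z\<close> has a next point \<open>t\<close> to the right, \<open>p\<close>
  moves in direction \<open>\<sigma>\<close> up to \<open>t\<close>, where \<open>q\<close> has the
  same sign by \<open>sgn_crit\<close>. Otherwise the gap is a ray, on which \<open>q\<close> is
  monotone in direction \<open>\<sigma>\<close> and unbounded, so that it finally takes the sign
  \<open>\<sigma>\<close>.\<close>

lemma sgn_right:
  assumes x: "x \<notin> Z" and s: "\<sigma> = sgn (poly (pderiv p) x)" and nn: "\<sigma> * poly p x \<ge> 0"
  shows "\<exists>t>x. (\<forall>s\<in>{x..<t}. s \<notin> Z) \<and> sgn (poly q (\<phi> t)) = \<sigma>"
proof (cases "\<exists>z\<in>Z. x < z")
  case True
  define t where "t = Min {z\<in>Z. x < z}"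
  have "t \<in> {z\<in>Z. x < z}"
    unfolding t_def using True finite_Z by (intro Min_in) auto
  then have t: "t \<in> Z" "x < t" by auto
  have noZ: "s \<notin> Z" if "s \<in> {x..<t}" for s
  proof
    assume "s \<in> Z"
    then have "s \<in> {z\<in>Z. x < z}" using that x by (cases "s = x") auto
    then have "t \<le> s" unfolding t_def using finite_Z by (intro Min_le) auto
    then show False using that by simp
  qed
  obtain \<xi> where \<xi>: "x < \<xi>" "\<xi> < t" using dense t by blast
  have "sgn (poly (pderiv p) x) = sgn (poly (pderiv p) \<xi>)"
    using \<xi> noZ by (intro deriv_sgn_const) auto
  moreover obtain e where "e > 0" "poly p t - poly p x = e * sgn (poly (pderiv p) \<xi>)"
    using MVT_sgn[of x t \<xi>] t noZ \<xi> by auto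
  ultimately have e: "poly p t = poly p x + e * \<sigma>" "e > 0" using s by auto
  have "\<sigma> = 1 \<or> \<sigma> = -1" using x s deriv_root by (auto simp: sgn_if)
  then have "sgn (poly p t) = \<sigma>" using e nn by (auto simp: sgn_if)
  moreover have "sgn (poly p t) = sgn (poly q (\<phi> t))"
    using t(1) sgn_crit unfolding Z_def by blast
  ultimately show ?thesis using t noZ by auto
next
  case False
  interpret c: sign_diagram "inv \<phi>" "R\<inverse>" q p by (rule converse)
  have noZ: "s \<notin> c.Z" if "\<phi> x \<le> s" for s
    using Z_converse[of "inv \<phi> s"] False x that
    by (metis le_iff linorder_not_less order.order_iff_strict phi_inv)
  have sq: "sgn (poly (pderiv q) (\<phi> x)) = \<sigma>" using sgn_match[OF deriv_mem] s by simp
  obtain y where y: "y \<ge> \<phi> x + 1" "\<bar>poly q y\<bar> > \<bar>poly q (\<phi> x)\<bar>"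
    using poly_unbounded_at_top c.degree_pos by blast
  obtain e where e: "e > 0" "poly q y - poly q (\<phi> x) = e * sgn (poly (pderiv q) (\<phi> x + 1/2))"
    using c.MVT_sgn[of "\<phi> x" y "\<phi> x + 1/2"] y noZ by auto
  have "sgn (poly (pderiv q) (\<phi> x)) = sgn (poly (pderiv q) (\<phi> x + 1/2))"
    using noZ by (intro c.deriv_sgn_const) auto
  then have "poly q y = poly q (\<phi> x) + e * \<sigma>" using e sq by auto
  moreover have "\<sigma> = 1 \<or> \<sigma> = -1" using x s deriv_root by (auto simp: sgn_if)
  ultimately have "sgn (poly q y) = \<sigma>" using e(1) y(2) by (auto simp: sgn_if)
  moreover have "x < inv \<phi> y" using y less_iff[of x "inv \<phi> y"] by simp
  ultimately show ?thesis using False x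
    by (intro exI[of _ "inv \<phi> y"]) (auto simp: order.order_iff_strict)
qed

lemma sgn_left:
  assumes x: "x \<notin> Z" and s: "\<sigma> = sgn (poly (pderiv p) x)" and nn: "\<sigma> * poly p x \<le> 0"
  shows "\<exists>t<x. (\<forall>s\<in>{t<..x}. s \<notin> Z) \<and> sgn (poly q (\<phi> t)) = - \<sigma>"
proof (cases "\<exists>z\<in>Z. z < x")
  case True
  define t where "t = Max {z\<in>Z. z < x}"
  have "t \<in> {z\<in>Z. z < x}"
    unfolding t_def using True finite_Z by (intro Max_in) auto
  then have t: "t \<in> Z" "t < x" by auto
  have noZ: "s \<notin> Z" if "s \<in> {t<..x}" for s
  proof
    assume "s \<in> Z"
    then have "s \<in> {z\<in>Z. z < x}" using that x by (cases "s = x") auto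
    then have "s \<le> t" unfolding t_def using finite_Z by (intro Max_ge) auto
    then show False using that by simp
  qed
  obtain \<xi> where \<xi>: "t < \<xi>" "\<xi> < x" using dense t by blast
  have "sgn (poly (pderiv p) \<xi>) = sgn (poly (pderiv p) x)"
    using \<xi> noZ by (intro deriv_sgn_const) auto
  moreover obtain e where "e > 0" "poly p x - poly p t = e * sgn (poly (pderiv p) \<xi>)"
    using MVT_sgn[of t x \<xi>] t noZ \<xi> by auto
  ultimately have e: "poly p t = poly p x - e * \<sigma>" "e > 0" using s by auto
  have "\<sigma> = 1 \<or> \<sigma> = -1" using x s deriv_root by (auto simp: sgn_if)
  then have "sgn (poly p t) = - \<sigma>" using e nn by (auto simp: sgn_if)
  moreover have "sgn (poly p t) = sgn (poly q (\<phi> t))"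
    using t(1) sgn_crit unfolding Z_def by blast
  ultimately show ?thesis using t noZ by auto
next
  case False
  interpret c: sign_diagram "inv \<phi>" "R\<inverse>" q p by (rule converse)
  have noZ: "s \<notin> c.Z" if "s \<le> \<phi> x" for s
    using Z_converse[of "inv \<phi> s"] False x that
    by (metis le_iff linorder_not_less order.order_iff_strict phi_inv)
  have sq: "sgn (poly (pderiv q) (\<phi> x)) = \<sigma>" using sgn_match[OF deriv_mem] s by simp
  obtain y where y: "y \<le> \<phi> x - 1" "\<bar>poly q y\<bar> > \<bar>poly q (\<phi> x)\<bar>"
    using poly_unbounded_at_bot c.degree_pos by blast
  obtain e where e: "e > 0" "poly q (\<phi> x) - poly q y = e * sgn (poly (pderiv q) (\<phi> x - 1/2))"
    using c.MVT_sgn[of y "\<phi> x" "\<phi> x - 1/2"] y noZ by auto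
  have "sgn (poly (pderiv q) (\<phi> x - 1/2)) = sgn (poly (pderiv q) (\<phi> x))"
    using noZ by (intro c.deriv_sgn_const) auto
  then have "poly q y = poly q (\<phi> x) - e * \<sigma>" using e sq by auto
  moreover have "\<sigma> = 1 \<or> \<sigma> = -1" using x s deriv_root by (auto simp: sgn_if)
  ultimately have "sgn (poly q y) = - \<sigma>" using e(1) y(2) by (auto simp: sgn_if)
  moreover have "inv \<phi> y < x" using y less_iff[of "inv \<phi> y" x] by simp
  ultimately show ?thesis using False x
    by (intro exI[of _ "inv \<phi> y"]) (auto simp: order.order_iff_strict)
qed

lemma IVT_phi:
  assumes "a < b" "sgn (poly q (\<phi> a)) = - sgn (poly q (\<phi> b))" "poly q (\<phi> b) \<noteq> 0"
  shows "\<exists>y. a < y \<and> y < b \<and> poly q (\<phi> y) = 0"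
proof -
  have "poly q (\<phi> a) * poly q (\<phi> b) < 0"
    using assms(2,3) by (auto simp: sgn_if mult_less_0_iff split: if_splits)
  then obtain w where "\<phi> a < w" "w < \<phi> b" "poly q w = 0"
    using poly_IVT[of "\<phi> a" "\<phi> b" q] assms(1) by auto
  then show ?thesis
    by (intro exI[of _ "inv \<phi> w"]) (metis less_iff phi_inv)
qed

text \<open>At a root of \<open>p\<close> both \<open>sgn_right\<close> and \<open>sgn_left\<close>
  apply, so \<open>q\<close> has opposite signs at the two ends of the gap and vanishes in
  between.\<close>

lemma corresponding_root:
  assumes x: "poly p x = 0" "x \<notin> Z"
  shows "\<exists>y. poly q (\<phi> y) = 0 \<and> (\<forall>t\<in>closed_segment x y. t \<notin> Z)"
proof -
  define \<sigma> where "\<sigma> = sgn (poly (pderiv p) x)"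
  have nz: "\<sigma> \<noteq> 0" using x deriv_root by (auto simp: \<sigma>_def sgn_0_0)
  obtain t1 where t1: "x < t1" "\<forall>s\<in>{x..<t1}. s \<notin> Z" "sgn (poly q (\<phi> t1)) = \<sigma>"
    using sgn_right[of x \<sigma>] x \<sigma>_def by auto
  obtain t2 where t2: "t2 < x" "\<forall>s\<in>{t2<..x}. s \<notin> Z" "sgn (poly q (\<phi> t2)) = - \<sigma>"
    using sgn_left[of x \<sigma>] x \<sigma>_def by auto
  obtain y where "t2 < y" "y < t1" "poly q (\<phi> y) = 0"
    using IVT_phi[of t2 t1] t1 t2 nz by force
  then show ?thesis using t1 t2 by (auto simp: closed_segment_eq_real_ivl split: if_splits)
qed

text \<open>By \<open>corresponding_root\<close> for the converse diagram and uniqueness of roots in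
  a gap, roots of \<open>q\<close> come from roots of \<open>p\<close> too. If the signs still
  differed at \<open>t\<close>, both values would be nonzero and opposite. In the direction in which
  \<open>p\<close> moves away from \<open>0\<close>, \<open>q\<close> would then have to change sign
  within the gap, at a root shared with \<open>p\<close>, where \<open>p\<close> cannot
  vanish.\<close>

lemma no_bad_imp_match:
  assumes good: "\<And>t. poly p t = 0 \<Longrightarrow> t \<notin> Z \<Longrightarrow> poly q (\<phi> t) = 0"
  shows "sgn (poly p t) = sgn (poly q (\<phi> t))"
proof (cases "t \<in> Z")
  case True
  then show ?thesis using sgn_crit unfolding Z_def by blast
next
  case t: False
  interpret c: sign_diagram "inv \<phi>" "R\<inverse>" q p by (rule converse)
  have roots: "poly p t = 0" if q: "poly q (\<phi> t) = 0" "t \<notin> Z" for t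
  proof -
    have "\<phi> t \<notin> c.Z" using q Z_converse by blast
    then obtain y where y: "poly p (inv \<phi> y) = 0" "\<forall>s\<in>closed_segment (\<phi> t) y. s \<notin> c.Z"
      using c.corresponding_root[of "\<phi> t"] q by blast
    have "inv \<phi> y \<notin> Z" using y(2) Z_converse[of "inv \<phi> y"] by auto
    then have "poly q y = 0" using good[OF y(1)] by simp
    then have "\<phi> t = y" using c.root_unique[of "\<phi> t" y] q y(2) by blast
    then show ?thesis using y(1) by auto
  qed
  define \<sigma> where "\<sigma> = sgn (poly (pderiv p) t)"
  have \<sigma>: "\<sigma> = 1 \<or> \<sigma> = -1" using t deriv_root by (auto simp: \<sigma>_def sgn_if)
  show ?thesis
  proof (rule ccontr)
    assume ne: "sgn (poly p t) \<noteq> sgn (poly q (\<phi> t))"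
    then have nz: "poly p t \<noteq> 0" using good t by auto
    then have nzq: "poly q (\<phi> t) \<noteq> 0" using roots t by blast
    have opp: "sgn (poly q (\<phi> t)) = - sgn (poly p t)"
      using ne nz nzq by (auto simp: sgn_if split: if_splits)
    consider "sgn (poly p t) = \<sigma>" | "sgn (poly p t) = - \<sigma>"
      using \<sigma> nz by (metis minus_minus sgn_if)
    then show False
    proof cases
      case 1
      then have "\<sigma> * poly p t \<ge> 0" using \<sigma> by (auto simp: sgn_if split: if_splits)
      then obtain t2 where t2: "t < t2" "\<forall>s\<in>{t..<t2}. s \<notin> Z" "sgn (poly q (\<phi> t2)) = \<sigma>"
        using sgn_right[OF t] \<sigma>_def by blast
      then obtain y where y: "t < y" "y < t2" "poly q (\<phi> y) = 0"
        using IVT_phi[of t t2] 1 opp \<sigma> by (metis sgn_0_0 zero_neq_neg_one zero_neq_one)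
      then have p0: "poly p y = 0" using roots t2 by auto
      obtain \<xi> where \<xi>: "t < \<xi>" "\<xi> < y" using dense y by blast
      have "sgn (poly (pderiv p) t) = sgn (poly (pderiv p) \<xi>)"
        using \<xi> y t2 by (intro deriv_sgn_const) auto
      then obtain e where "e > 0" "poly p y - poly p t = e * \<sigma>"
        using MVT_sgn[of t y \<xi>] y t2 \<xi> \<sigma>_def by auto
      then show False using 1 p0 \<sigma> by (auto simp: sgn_if split: if_splits)
    next
      case 2
      then have "\<sigma> * poly p t \<le> 0" using \<sigma> by (auto simp: sgn_if split: if_splits)
      then obtain t2 where t2: "t2 < t" "\<forall>s\<in>{t2<..t}. s \<notin> Z" "sgn (poly q (\<phi> t2)) = - \<sigma>"
        using sgn_left[OF t] \<sigma>_def by blast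
      then obtain y where y: "t2 < y" "y < t" "poly q (\<phi> y) = 0"
        using IVT_phi[of t2 t] 2 opp nzq by auto
      then have p0: "poly p y = 0" using roots t2 by auto
      obtain \<xi> where \<xi>: "y < \<xi>" "\<xi> < t" using dense y by blast
      have "sgn (poly (pderiv p) \<xi>) = sgn (poly (pderiv p) t)"
        using \<xi> y t2 by (intro deriv_sgn_const) auto
      then obtain e where "e > 0" "poly p t - poly p y = e * \<sigma>"
        using MVT_sgn[of y t \<xi>] y t2 \<xi> \<sigma>_def by auto
      then show False using 2 p0 \<sigma> by (auto simp: sgn_if split: if_splits)
    qed
  qed
qed

definition bad :: "real set" where
  "bad = {t. poly p t = 0 \<and> t \<notin> Z \<and> poly q (\<phi> t) \<noteq> 0}"

lemma finite_bad: "finite bad"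
proof (rule finite_subset)
  show "bad \<subseteq> {t. poly p t = 0}" unfolding bad_def by blast
  have "p \<noteq> 0" using degree_pos by auto
  then show "finite {t. poly p t = 0}" by (rule poly_roots_finite)
qed

text \<open>The image of \<open>x\<close> is moved onto the corresponding root of \<open>q\<close>,
  inside an interval free of roots of the matched polynomials, so all signs already matched survive.
  No bad point is created: \<open>x\<close> is the only root of \<open>p\<close> whose image lies in
  that interval.\<close>

lemma reduce_bad:
  assumes "x \<in> bad"
  shows "\<exists>\<phi>'. sign_diagram \<phi>' R p q \<and> sign_diagram.bad \<phi>' R p q \<subset> bad"
proof -
  interpret c: sign_diagram "inv \<phi>" "R\<inverse>" q p by (rule converse)
  have x: "poly p x = 0" "x \<notin> Z" using assms bad_def by auto
  obtain y where y: "poly q (\<phi> y) = 0" "\<forall>t\<in>closed_segment x y. t \<notin> Z"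
    using corresponding_root[OF x] by blast
  define l where "l = \<phi> (min x y)"
  define h where "h = \<phi> (max x y)"
  have seg: "{l..h} \<inter> c.Z = {}"
  proof -
    have "s \<notin> c.Z" if "l \<le> s" "s \<le> h" for s
    proof -
      have "min x y \<le> inv \<phi> s" "inv \<phi> s \<le> max x y"
        using that le_iff[of "min x y" "inv \<phi> s"] le_iff[of "inv \<phi> s" "max x y"]
        by (simp_all add: l_def h_def)
      then have "inv \<phi> s \<notin> Z"
        using y(2) by (auto simp: closed_segment_eq_real_ivl min_def max_def split: if_splits)
      then show ?thesis using Z_converse[of "inv \<phi> s"] by simp
    qed
    then show ?thesis by auto
  qed
  have op: "open (- c.Z)" using c.finite_Z finite_imp_closed by blast
  have "l \<le> h" by (simp add: l_def h_def)
  then have lh_notin: "l \<in> - c.Z" "h \<in> - c.Z" using seg by auto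
  obtain e1 where e1: "e1 > 0" "ball l e1 \<subseteq> - c.Z"
    using openE[OF op, of l] lh_notin by blast
  obtain e2 where e2: "e2 > 0" "ball h e2 \<subseteq> - c.Z"
    using openE[OF op, of h] lh_notin by blast
  \<comment> \<open>The images of \<open>x\<close> and \<open>y\<close> are the ends of
    \<open>[l, h]\<close>, whereas the bijection moves only interior points; hence the margin on
    both sides.\<close>
  define a where "a = l - e1 / 2"
  define b where "b = h + e2 / 2"
  have noZ: "s \<notin> c.Z" if "a \<le> s" "s \<le> b" for s
  proof -
    consider "l \<le> s" "s \<le> h" | "s < l" | "h < s" by linarith
    then show ?thesis
    proof cases
      case 2
      then have "s \<in> ball l e1" using that e1 by (simp add: a_def dist_real_def)
      then show ?thesis using e1 by blast
    next
      case 3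
      then have "s \<in> ball h e2" using that e2 by (simp add: b_def dist_real_def)
      then show ?thesis using e2 by blast
    qed (use seg in auto)
  qed
  have lh': "l \<le> \<phi> x" "l \<le> \<phi> y" "\<phi> x \<le> h" "\<phi> y \<le> h" by (simp_all add: l_def h_def)
  then have "a < \<phi> x" "\<phi> x < b" "a < \<phi> y" "\<phi> y < b"
    using e1 e2 by (auto simp: a_def b_def)
  then obtain \<alpha> where \<alpha>: "strict_mono \<alpha>" "surj \<alpha>" "\<alpha> (\<phi> x) = \<phi> y"
      "\<And>t. t \<le> a \<or> b \<le> t \<Longrightarrow> \<alpha> t = t"
    using ex_increasing_bij_moving[of a "\<phi> x" b "\<phi> y"] by blast
  have inside: "a \<le> \<alpha> s \<and> \<alpha> s \<le> b" if "a \<le> s" "s \<le> b" for s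
    using strict_mono_less_eq[OF \<alpha>(1), of a s] strict_mono_less_eq[OF \<alpha>(1), of s b] that
      \<alpha>(4)[of a] \<alpha>(4)[of b] by simp
  have unmoved: "(\<alpha> \<circ> \<phi>) t = \<phi> t" if "t \<in> Z" for t
  proof -
    have "\<phi> t \<le> a \<or> b \<le> \<phi> t" using that noZ[of "\<phi> t"] Z_converse[of t] by (meson linear)
    then show ?thesis using \<alpha>(4) by simp
  qed
  have sd: "sign_diagram (\<alpha> \<circ> \<phi>) R p q"
  proof
    show "strict_mono (\<alpha> \<circ> \<phi>)" using \<alpha>(1) mono by (simp add: strict_mono_def)
    show "surj (\<alpha> \<circ> \<phi>)" using \<alpha>(2) onto comp_surj by blast
    show "finite R" "(pderiv p, pderiv q) \<in> R" "pderiv p \<noteq> 0" by (fact fin deriv_mem deriv_nz)+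
    show "sgn (poly r t) = sgn (poly r' ((\<alpha> \<circ> \<phi>) t))" if r: "(r, r') \<in> R" for r r' t
    proof (cases "r' = 0 \<or> \<phi> t \<le> a \<or> b \<le> \<phi> t")
      case True
      then show ?thesis using sgn_match[OF r, of t] \<alpha>(4) by auto
    next
      case False
      have nz: "poly r' s \<noteq> 0" if "a \<le> s" "s \<le> b" for s
        using noZ[OF that] r False unfolding c.Z_def by blast
      have "sgn (poly r' (min (\<phi> t) (\<alpha> (\<phi> t)))) = sgn (poly r' (max (\<phi> t) (\<alpha> (\<phi> t))))"
        using inside[of "\<phi> t"] False by (intro poly_sgn_const nz) auto
      then show ?thesis using sgn_match[OF r, of t] by (auto simp: min_def max_def split: if_splits)
    qed
    show "sgn (poly p t) = sgn (poly q ((\<alpha> \<circ> \<phi>) t))" if "(r, r') \<in> R" "r \<noteq> 0" "poly r t = 0" for r r' t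
    proof -
      have "t \<in> Z" using that unfolding Z_def by blast
      then show ?thesis using sgn_crit[OF that] unmoved by simp
    qed
  qed
  interpret n: sign_diagram "\<alpha> \<circ> \<phi>" R p q by (rule sd)
  have "x \<notin> n.bad" using y(1) \<alpha>(3) by (simp add: n.bad_def)
  moreover have "n.bad \<subseteq> bad"
  proof
    fix t assume t: "t \<in> n.bad"
    have pt: "poly p t = 0" "t \<notin> Z" "poly q (\<alpha> (\<phi> t)) \<noteq> 0"
      using t by (auto simp: n.bad_def)
    have "\<phi> t \<le> a \<or> b \<le> \<phi> t"
    proof (rule ccontr)
      assume c: "\<not> (\<phi> t \<le> a \<or> b \<le> \<phi> t)"
      have "s \<notin> Z" if "s \<in> closed_segment x t" for s
      proof -
        have "\<phi> s \<in> {min (\<phi> x) (\<phi> t)..max (\<phi> x) (\<phi> t)}"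
          using that by (auto simp: closed_segment_eq_real_ivl split: if_splits)
        then have "\<phi> s \<notin> c.Z" using c \<open>a < \<phi> x\<close> \<open>\<phi> x < b\<close> by (intro noZ) auto
        then show ?thesis using Z_converse by blast
      qed
      then have "t = x" using root_unique[OF x(1) pt(1)] by blast
      then show False using \<open>x \<notin> n.bad\<close> t by blast
    qed
    then show "t \<in> bad" using pt \<alpha>(4) unfolding bad_def by auto
  qed
  ultimately show ?thesis using sd assms by blast
qed

lemma ex_match: "\<exists>\<phi>'. strict_mono \<phi>' \<and> surj \<phi>' \<and>
    (\<forall>(r, r') \<in> insert (p, q) R. \<forall>t. sgn (poly r t) = sgn (poly r' (\<phi>' t)))"
proof -
  have "\<exists>\<phi>'. strict_mono \<phi>' \<and> surj \<phi>' \<and>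
    (\<forall>(r, r') \<in> insert (p, q) R. \<forall>t. sgn (poly r t) = sgn (poly r' (\<phi>' t)))"
    if "sign_diagram \<psi> R p q" "card (sign_diagram.bad \<psi> R p q) = n" for \<psi> n
    using that
  proof (induction n arbitrary: \<psi> rule: less_induct)
    case (less n)
    interpret s: sign_diagram \<psi> R p q by (fact less.prems)
    show ?case
    proof (cases "s.bad = {}")
      case True
      then have "sgn (poly p t) = sgn (poly q (\<psi> t))" for t
        by (intro s.no_bad_imp_match) (auto simp: s.bad_def)
      then show ?thesis using s.mono s.onto s.sgn_match by (intro exI[of _ \<psi>]) auto
    next
      case False
      then obtain \<psi>' where \<psi>': "sign_diagram \<psi>' R p q" "sign_diagram.bad \<psi>' R p q \<subset> s.bad"
        using s.reduce_bad by blast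
      then show ?thesis using less.IH less.prems(2) psubset_card_mono[OF s.finite_bad] by blast
    qed
  qed
  then show ?thesis using sign_diagram_axioms by blast
qed

end

section \<open>Projections of semialgebraic sets\<close>

lemma poly_fun_sum: "(\<And>i. i \<in> I \<Longrightarrow> poly_fun (f i)) \<Longrightarrow> poly_fun (\<lambda>y. \<Sum>i\<in>I. f i y)"
proof (induction I rule: infinite_finite_induct)
  case (insert i I)
  then show ?case using pf_add[of "f i" "\<lambda>y. \<Sum>i\<in>I. f i y"] by simp
qed (simp_all add: pf_const)

lemma poly_fun_cmult: "poly_fun p \<Longrightarrow> poly_fun (\<lambda>y. c * p y)"
  using pf_mult[OF pf_const] .

lemma poly_fun_diff: "poly_fun p \<Longrightarrow> poly_fun q \<Longrightarrow> poly_fun (\<lambda>y. p y - q y)"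
  using pf_add[OF _ poly_fun_cmult[of q "-1"], of p] by simp

lemma poly_fun_power: "poly_fun p \<Longrightarrow> poly_fun (\<lambda>y. p y ^ n)"
  by (induction n) (auto intro: pf_const pf_mult)

lemma poly_fun_compose:
  assumes "poly_fun p" "\<And>b. b \<in> Basis \<Longrightarrow> poly_fun (\<lambda>x. f x \<bullet> b)"
  shows "poly_fun (\<lambda>x. p (f x))"
  using assms by induction (auto intro: poly_fun.intros)

lemma poly_fun_inner: "poly_fun (\<lambda>y. y \<bullet> v)"
proof -
  have "(\<lambda>y. y \<bullet> v) = (\<lambda>y. \<Sum>b\<in>Basis. (v \<bullet> b) * (y \<bullet> b))"
    by (rule ext) (subst euclidean_inner, simp add: mult.commute)
  then show ?thesis by (auto intro!: poly_fun_sum poly_fun_cmult pf_coord)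
qed

lemma poly_fun_linear: "linear f \<Longrightarrow> poly_fun f" for f :: "'a::euclidean_space \<Rightarrow> real"
  using poly_fun_inner[of "adjoint f 1"] adjoint_works[of f _ 1] by simp

lemma poly_fun_compose_linear:
  assumes "poly_fun p" "linear f"
  shows "poly_fun (\<lambda>x. p (f x))"
  using assms(1)
proof (rule poly_fun_compose)
  fix b
  show "poly_fun (\<lambda>x. f x \<bullet> b)"
    by (intro poly_fun_linear linear_compose[OF assms(2), unfolded o_def]
        bounded_linear.linear bounded_linear_inner_left)
qed

text \<open>
  A pair \<open>(n, c)\<close> stands for the polynomial with coefficients \<open>c i z\<close>, \<open>i < n\<close>,
  in one variable, depending on a parameter \<open>z\<close>; \<open>n\<close> is only a bound for the degree,
  since the leading coefficient may vanish for some parameters.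
\<close>

type_synonym 'c ppoly = "nat \<times> (nat \<Rightarrow> 'c \<Rightarrow> real)"

definition at_param :: "'c ppoly \<Rightarrow> 'c \<Rightarrow> real poly" where
  "at_param a z = (\<Sum>i<fst a. monom (snd a i z) i)"

definition poly_coeffs :: "'c::euclidean_space ppoly \<Rightarrow> bool" where
  "poly_coeffs a \<longleftrightarrow> (\<forall>i. poly_fun (snd a i))"

lemma coeff_at_param: "coeff (at_param a z) i = (if i < fst a then snd a i z else 0)"
  by (simp add: at_param_def coeff_sum)

lemma at_param_cong:
  "(\<And>i. (if i < fst a then snd a i z else 0) = (if i < fst b then snd b i z else 0)) \<Longrightarrow> at_param a z = at_param b z"
  by (rule poly_eqI) (simp add: coeff_at_param)

text \<open>Coefficients have to stay polynomial in \<open>z\<close>, so division is replaced by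
  scaling. The factor is the square of the leading coefficient of \<open>r\<close>, which is
  positive where that coefficient does not vanish; at a root of \<open>r\<close> the subtracted
  multiple of \<open>r\<close> disappears, so the sign is kept.\<close>

lemma pseudo_remainder:
  assumes "poly_coeffs a" "poly_coeffs r" "fst r > 0"
  shows "\<exists>d. poly_coeffs d \<and> fst d < fst r \<and>
    (\<forall>z t. snd r (fst r - 1) z \<noteq> 0 \<longrightarrow> poly (at_param r z) t = 0 \<longrightarrow>
      sgn (poly (at_param a z) t) = sgn (poly (at_param d z) t))"
  using assms(1)
proof (induction "fst a" arbitrary: a rule: less_induct)
  case less
  show ?case
  proof (cases "fst a < fst r")
    case True
    then show ?thesis using less.prems by blast
  next
    case False
    define n m k where "n = fst a" and "m = fst r" and "k = n - m"
    define lr la where "lr = snd r (m - 1)" and "la = snd a (n - 1)"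
    have nm: "m \<le> n" "0 < m" using False assms(3) by (auto simp: n_def m_def)
    define a1 where "a1 = (n - 1, \<lambda>i z. lr z * lr z * snd a i z -
      lr z * la z * (if k \<le> i then snd r (i - k) z else 0))"
    have "poly_fun (\<lambda>z. if k \<le> i then snd r (i - k) z else 0)" for i
      using assms(2) pf_const by (cases "k \<le> i") (auto simp: poly_coeffs_def)
    then have ok: "poly_coeffs a1"
      using less.prems assms(2) unfolding a1_def poly_coeffs_def lr_def la_def
      by (auto intro!: poly_fun_diff pf_mult)
    have eq: "at_param a1 z = smult (lr z * lr z) (at_param a z)
        - smult (lr z * la z) (monom 1 k * at_param r z)" for z
    proof (rule poly_eqI)
      fix i
      consider "i < n - 1" | "i = n - 1" | "i \<ge> n" by linarith
      then show "coeff (at_param a1 z) i = coeff (smult (lr z * lr z) (at_param a z)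
          - smult (lr z * la z) (monom 1 k * at_param r z)) i"
      proof cases
        case 1
        moreover have "i - k < m" using 1 nm by (simp add: k_def)
        ultimately show ?thesis using nm
          by (simp add: coeff_at_param coeff_monom_mult a1_def n_def m_def)
      next
        case 2
        have "k \<le> i" "i - k = m - 1" "i < n" "m - 1 < m" using 2 nm by (auto simp: k_def)
        then show ?thesis using 2
          by (simp add: coeff_at_param coeff_monom_mult a1_def lr_def la_def flip: n_def m_def)
      next
        case 3
        then have "\<not> i - k < m" "\<not> i < n - 1" "\<not> i < n" using nm by (auto simp: k_def)
        then show ?thesis
          by (simp add: coeff_at_param coeff_monom_mult a1_def flip: n_def m_def)
      qed
    qed
    have "fst a1 < fst a" using nm by (simp add: a1_def n_def m_def)
    then obtain d where d: "poly_coeffs d" "fst d < fst r"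
      "\<And>z t. snd r (fst r - 1) z \<noteq> 0 \<Longrightarrow> poly (at_param r z) t = 0 \<Longrightarrow>
        sgn (poly (at_param a1 z) t) = sgn (poly (at_param d z) t)"
      using less.hyps[of a1] ok by blast
    have "sgn (poly (at_param a z) t) = sgn (poly (at_param d z) t)"
      if "snd r (fst r - 1) z \<noteq> 0" "poly (at_param r z) t = 0" for z t
    proof -
      have "poly (at_param a1 z) t = lr z * lr z * poly (at_param a z) t"
        using that by (simp add: eq)
      moreover have "lr z \<noteq> 0" using that by (simp add: lr_def m_def)
      ultimately show ?thesis using d(3)[OF that] by (simp add: sgn_mult)
    qed
    then show ?thesis using d by blast
  qed
qed

definition sgn_equiv :: "('c \<Rightarrow> real) set \<Rightarrow> 'c \<Rightarrow> 'c \<Rightarrow> bool" where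
  "sgn_equiv A z z' \<longleftrightarrow> (\<forall>f\<in>A. sgn (f z) = sgn (f z'))"

definition same_diagram :: "'c ppoly set \<Rightarrow> 'c \<Rightarrow> 'c \<Rightarrow> (real \<Rightarrow> real) \<Rightarrow> bool" where
  "same_diagram L z z' \<phi> \<longleftrightarrow> strict_mono \<phi> \<and> surj \<phi> \<and>
     (\<forall>a\<in>L. \<forall>t. sgn (poly (at_param a z) t) = sgn (poly (at_param a z') (\<phi> t)))"

text \<open>This is the elimination of the variable \<open>t\<close>: a single finite set of
  conditions on the parameter decides the sign diagram for all parameters simultaneously.\<close>

definition diagram_determined :: "'c::euclidean_space ppoly set \<Rightarrow> bool" where
  "diagram_determined L \<longleftrightarrow> (\<exists>A. finite A \<and> (\<forall>f\<in>A. poly_fun f) \<and>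
     (\<forall>z z'. sgn_equiv A z z' \<longrightarrow> (\<exists>\<phi>. same_diagram L z z' \<phi>)))"

text \<open>
  \<open>E\<close> consists of the derivative and the truncation of \<open>p\<close> and of its pseudo-remainders
  modulo all truncations of the other polynomials: at a root of \<open>r\<close>, \<open>p\<close> has the sign
  of its remainder modulo \<open>r\<close>.
\<close>

lemma diagram_step:
  fixes L :: "'c::euclidean_space ppoly set"
  assumes fin: "finite L" and ok: "\<And>a. a \<in> L \<Longrightarrow> poly_coeffs a"
    and len: "\<And>a. a \<in> L \<Longrightarrow> fst a \<le> Suc d" and p: "p \<in> L" "fst p = Suc d"
  shows "\<exists>E. finite E \<and> (\<forall>a\<in>E. poly_coeffs a \<and> fst a \<le> d) \<and>
    (diagram_determined ((L - {p}) \<union> E) \<longrightarrow> diagram_determined L)"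
proof -
  define dp where "dp = (d, \<lambda>i z. real (Suc i) * snd p (Suc i) z)"
  define R where "R = insert dp (L - {p})"
  have okp: "poly_coeffs p" using ok p by blast
  have okdp: "poly_coeffs dp"
    using okp unfolding dp_def poly_coeffs_def by (auto intro: poly_fun_cmult)
  have okR: "poly_coeffs r" if "r \<in> R" for r using that okdp ok unfolding R_def by blast
  have finR: "finite R" using fin by (simp add: R_def)
  have lenR: "fst r \<le> Suc d" if "r \<in> R" for r
    using that len[of r] unfolding R_def dp_def by auto
  have "\<forall>r j. \<exists>e. r \<in> R \<longrightarrow> 0 < j \<longrightarrow> poly_coeffs e \<and> fst e < j \<and>
      (\<forall>z t. snd r (j - 1) z \<noteq> 0 \<longrightarrow> poly (at_param (j, snd r) z) t = 0 \<longrightarrow>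
        sgn (poly (at_param p z) t) = sgn (poly (at_param e z) t))"
  proof (intro allI)
    fix r j
    show "\<exists>e. r \<in> R \<longrightarrow> 0 < j \<longrightarrow> poly_coeffs e \<and> fst e < j \<and>
      (\<forall>z t. snd r (j - 1) z \<noteq> 0 \<longrightarrow> poly (at_param (j, snd r) z) t = 0 \<longrightarrow>
        sgn (poly (at_param p z) t) = sgn (poly (at_param e z) t))"
      using pseudo_remainder[OF okp, of "(j, snd r)"] okR[of r]
      by (cases "r \<in> R \<and> 0 < j") (auto simp: poly_coeffs_def)
  qed
  then have "\<exists>rem. \<forall>r j. r \<in> R \<longrightarrow> 0 < j \<longrightarrow> poly_coeffs (rem r j) \<and> fst (rem r j) < j \<and>
      (\<forall>z t. snd r (j - 1) z \<noteq> 0 \<longrightarrow> poly (at_param (j, snd r) z) t = 0 \<longrightarrow>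
        sgn (poly (at_param p z) t) = sgn (poly (at_param (rem r j) z) t))"
    unfolding choice_iff .
  then obtain rem where rem: "\<And>r j. r \<in> R \<Longrightarrow> 0 < j \<Longrightarrow> poly_coeffs (rem r j) \<and> fst (rem r j) < j \<and>
      (\<forall>z t. snd r (j - 1) z \<noteq> 0 \<longrightarrow> poly (at_param (j, snd r) z) t = 0 \<longrightarrow>
        sgn (poly (at_param p z) t) = sgn (poly (at_param (rem r j) z) t))"
    by blast
  define tr where "tr = (d, snd p)"
  \<comment> \<open>Every formal length \<open>j\<close> is listed because the true degree of
    \<open>r\<close> depends on the parameter. Since the remainder is shorter than \<open>j\<close>,
    which is at most \<open>Suc d\<close>, its length is at most \<open>d\<close>.\<close>
  define Q where "Q = (\<lambda>(r, j). rem r j) ` (SIGMA r:R. {1..fst r})"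
  define E where "E = insert dp (insert tr Q)"
  have Q_mem: "rem r j \<in> E" if "r \<in> R" "0 < j" "j \<le> fst r" for r j
  proof -
    have "(r, j) \<in> (SIGMA r:R. {1..fst r})" using that by simp
    then have "(\<lambda>(r, j). rem r j) (r, j) \<in> Q" unfolding Q_def by (rule imageI)
    then show ?thesis by (simp add: E_def)
  qed
  have "finite E" using finR by (auto simp: E_def Q_def intro!: finite_imageI finite_SigmaI)
  moreover have "poly_coeffs a \<and> fst a \<le> d" if "a \<in> E" for a
  proof -
    have Q_cases: "\<exists>r j. r \<in> R \<and> 0 < j \<and> j \<le> fst r \<and> a = rem r j" if "a \<in> Q"
    proof -
      obtain x where "x \<in> (SIGMA r:R. {1..fst r})" "a = (\<lambda>(r, j). rem r j) x"
        using \<open>a \<in> Q\<close> unfolding Q_def by blast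
      then show ?thesis by (intro exI[of _ "fst x"] exI[of _ "snd x"]) (cases x, simp)
    qed
    consider "a = dp" | "a = tr" | "a \<in> Q" using \<open>a \<in> E\<close> unfolding E_def by blast
    then show ?thesis
    proof cases
      case 3
      then obtain r j where rj: "r \<in> R" "0 < j" "j \<le> fst r" "a = rem r j" using Q_cases by blast
      then have "poly_coeffs a" "fst a < j" using rem[of r j] by blast+
      then show ?thesis using rj(3) lenR[OF rj(1)] by simp
    qed (use okdp okp in \<open>auto simp: dp_def tr_def poly_coeffs_def\<close>)
  qed
  moreover have "diagram_determined L" if det: "diagram_determined ((L - {p}) \<union> E)"
  proof -
    obtain A where A: "finite A" "\<And>f. f \<in> A \<Longrightarrow> poly_fun f"
      "\<And>z z'. sgn_equiv A z z' \<Longrightarrow> \<exists>\<phi>. same_diagram ((L - {p}) \<union> E) z z' \<phi>"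
      using det unfolding diagram_determined_def by blast
    \<comment> \<open>The signs of all coefficients are added to \<open>A\<close>: indices up to
      \<open>d\<close> suffice as lengths are at most \<open>Suc d\<close>. Equivalent parameters
      then give each polynomial the same true degree.\<close>
    define C where "C = (\<lambda>(r, j). snd r j) ` (insert p R \<times> {..d})"
    have finC: "finite C" unfolding C_def using finR by (intro finite_imageI) simp
    have polyC: "poly_fun f" if "f \<in> C" for f
      using that okp okR unfolding C_def poly_coeffs_def by auto
    have "\<exists>\<phi>. same_diagram L z z' \<phi>" if eq: "sgn_equiv (A \<union> C) z z'" for z z'
    proof -
      have eqC: "sgn (snd r j z) = sgn (snd r j z')" if "r \<in> insert p R" "j \<le> d" for r j
      proof -
        have "snd r j \<in> C" using that unfolding C_def by (intro image_eqI[of _ _ "(r, j)"]) auto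
        then show ?thesis using eq unfolding sgn_equiv_def by blast
      qed
      obtain \<phi> where \<phi>: "same_diagram ((L - {p}) \<union> E) z z' \<phi>"
        using A(3)[of z z'] eq unfolding sgn_equiv_def by blast
      then have mono: "strict_mono \<phi>" and onto: "surj \<phi>"
        and match: "\<And>a t. a \<in> (L - {p}) \<union> E \<Longrightarrow>
          sgn (poly (at_param a z) t) = sgn (poly (at_param a z') (\<phi> t))"
        unfolding same_diagram_def by blast+
      have finish: ?thesis if "\<And>t. sgn (poly (at_param p z) t) = sgn (poly (at_param p z') (\<phi> t))"
        unfolding same_diagram_def
      proof (intro exI[of _ \<phi>] conjI ballI allI)
        fix a t assume "a \<in> L"
        then show "sgn (poly (at_param a z) t) = sgn (poly (at_param a z') (\<phi> t))"
          using match[of a t] that by (cases "a = p") auto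
      qed (fact mono onto)+
      have lead: "snd p d z = 0 \<longleftrightarrow> snd p d z' = 0"
        using eqC[of p d] by (metis insertI1 order_refl sgn_0_0)
      consider "snd p d z = 0" | "snd p d z \<noteq> 0" "d = 0" | "snd p d z \<noteq> 0" "d > 0" by blast
      then show ?thesis
      proof cases
        case 1
        have "at_param p w = at_param tr w" if "snd p d w = 0" for w
          using that by (intro at_param_cong) (auto simp: tr_def p(2) less_Suc_eq)
        then have "at_param p z = at_param tr z" "at_param p z' = at_param tr z'"
          using 1 lead by blast+
        moreover have "tr \<in> E" by (simp add: E_def)
        ultimately show ?thesis using match[of tr] by (intro finish) simp
      next
        case 2
        then have "poly (at_param p w) t = snd p 0 w" for w t
          by (simp add: at_param_def p(2) poly_monom)
        then show ?thesis using eqC[of p 0] by (intro finish) simp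
      next
        case 3
        define RR where "RR = (\<lambda>r. (at_param r z, at_param r z')) ` R"
        have dpw: "pderiv (at_param p w) = at_param dp w" for w
          by (rule poly_eqI) (simp add: coeff_pderiv coeff_at_param dp_def p(2))
        have RE: "r \<in> (L - {p}) \<union> E" if "r \<in> R" for r
          using that by (auto simp: R_def E_def)
        interpret sign_diagram \<phi> RR "at_param p z" "at_param p z'"
        proof
          show "strict_mono \<phi>" "surj \<phi>" by (fact mono onto)+
          show "finite RR" using finR by (simp add: RR_def)
          show "sgn (poly r t) = sgn (poly r' (\<phi> t))" if "(r, r') \<in> RR" for r r' t
            using that match RE unfolding RR_def by blast
          show "(pderiv (at_param p z), pderiv (at_param p z')) \<in> RR"
            unfolding dpw RR_def R_def by blast
          have "coeff (at_param dp z) (d - 1) \<noteq> 0"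
            using 3 by (simp add: coeff_at_param dp_def)
          then show "pderiv (at_param p z) \<noteq> 0" unfolding dpw by auto
          show "sgn (poly (at_param p z) t) = sgn (poly (at_param p z') (\<phi> t))"
            if rr: "(r, r') \<in> RR" and nz: "r \<noteq> 0" and root: "poly r t = 0" for r r' t
          proof -
            obtain s where s: "s \<in> R" "r = at_param s z" "r' = at_param s z'"
              using rr unfolding RR_def by blast
            \<comment> \<open>Truncation at \<open>j\<close> removes exactly the vanishing top
              coefficients, at \<open>z\<close> and at \<open>z'\<close> alike. Its leading
              coefficient is nonzero at both, so the same pseudo-remainder gives the sign of
              \<open>p\<close> at the root and at its image.\<close>
            define j where "j = Suc (degree r)"
            have lc: "coeff r (j - 1) \<noteq> 0" using nz by (simp add: j_def)
            then have j: "j \<le> fst s" "snd s (j - 1) z \<noteq> 0"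
              unfolding s(2) coeff_at_param by (auto split: if_splits)
            have jd: "j - 1 \<le> d" using j lenR[OF s(1)] by simp
            have hi: "snd s i z = 0" if "j \<le> i" "i < fst s" for i
              using that coeff_eq_0[of r i] unfolding s(2) coeff_at_param j_def by auto
            then have hi': "snd s i z' = 0" if "j \<le> i" "i < fst s" for i
              using that eqC[of s i] lenR[OF s(1)] s(1) by (simp add: sgn_0_0)
            have z: "r = at_param (j, snd s) z" "r' = at_param (j, snd s) z'"
              unfolding s(2,3) using hi hi' j by (auto intro!: at_param_cong)
            have j': "snd s (j - 1) z' \<noteq> 0"
              using j(2) eqC[of s "j - 1"] jd s(1) by (metis insertI2 sgn_0_0)
            have root': "poly r' (\<phi> t) = 0"
              using match[OF RE[OF s(1)], of t] root unfolding s(2,3) by (simp add: sgn_0_0)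
            have j0: "0 < j" by (simp add: j_def)
            have "sgn (poly (at_param p z) t) = sgn (poly (at_param (rem s j) z) t)"
              using rem[OF s(1) j0] j(2) root z(1) by auto
            also have "\<dots> = sgn (poly (at_param (rem s j) z') (\<phi> t))"
              using match[of "rem s j"] Q_mem[OF s(1) j0 j(1)] by blast
            also have "\<dots> = sgn (poly (at_param p z') (\<phi> t))"
              using rem[OF s(1) j0] j' root' z(2) by auto
            finally show ?thesis .
          qed
        qed
        obtain \<phi>' where \<phi>': "strict_mono \<phi>'" "surj \<phi>'"
          "\<forall>(r, r') \<in> insert (at_param p z, at_param p z') RR.
             \<forall>t. sgn (poly r t) = sgn (poly r' (\<phi>' t))"
          using ex_match by blast
        have "sgn (poly (at_param a z) t) = sgn (poly (at_param a z') (\<phi>' t))" if "a \<in> L" for a t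
        proof -
          have "(at_param a z, at_param a z') \<in> insert (at_param p z, at_param p z') RR"
            using that unfolding RR_def R_def by blast
          then show ?thesis using \<phi>'(3) by blast
        qed
        then show ?thesis using \<phi>' unfolding same_diagram_def by blast
      qed
    qed
    then show ?thesis
      unfolding diagram_determined_def using A(1,2) finC polyC
      by (intro exI[of _ "A \<union> C"]) blast
  qed
  ultimately show ?thesis by blast
qed

text \<open>Nested induction on the maximal length and on the number of polynomials attaining it:
  \<open>diagram_step\<close> trades one of them for finitely many shorter ones. At length
  \<open>0\<close> all polynomials are zero and the identity matches them.\<close>

theorem diagram_determined:
  fixes L :: "'c::euclidean_space ppoly set"
  assumes "finite L" "\<And>a. a \<in> L \<Longrightarrow> poly_coeffs a"
  shows "diagram_determined L"
proof -
  have main: "diagram_determined L"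
    if "finite L" "\<And>a. a \<in> L \<Longrightarrow> poly_coeffs a" "\<And>a. a \<in> L \<Longrightarrow> fst a \<le> d"
    for d and L :: "'c ppoly set"
    using that
  proof (induction d arbitrary: L)
    case 0
    then have "poly (at_param a z) t = 0" if "a \<in> L" for a z t
      using that by (simp add: at_param_def)
    then show ?case
      unfolding diagram_determined_def same_diagram_def
      by (intro exI[of _ "{}"]) (auto intro!: exI[of _ "\<lambda>t. t"] simp: strict_mono_def)
  next
    case (Suc d)
    have "diagram_determined L"
      if "finite L" "\<And>a. a \<in> L \<Longrightarrow> poly_coeffs a" "\<And>a. a \<in> L \<Longrightarrow> fst a \<le> Suc d"
        "card {a \<in> L. fst a = Suc d} = n" for n and L :: "'c ppoly set"
      using that
    proof (induction n arbitrary: L)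
      case 0
      then have "{a \<in> L. fst a = Suc d} = {}"
        using card_0_eq[of "{a \<in> L. fst a = Suc d}"] by simp
      then have "fst a \<le> d" if "a \<in> L" for a using that 0(3)[OF that] le_SucE by blast
      then show ?case using 0 by (intro Suc.IH)
    next
      case (Suc n)
      have "{a \<in> L. fst a = Suc d} \<noteq> {}" using Suc.prems(4) by (metis card.empty nat.distinct(1))
      then obtain p where p: "p \<in> L" "fst p = Suc d" by blast
      obtain E where E: "finite E" "\<forall>a\<in>E. poly_coeffs a \<and> fst a \<le> d"
        "diagram_determined ((L - {p}) \<union> E) \<longrightarrow> diagram_determined L"
        using diagram_step[of L d p] Suc.prems p by blast
      have "{a \<in> (L - {p}) \<union> E. fst a = Suc d} = {a \<in> L. fst a = Suc d} - {p}"
        using E(2) by fastforce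
      then have "card {a \<in> (L - {p}) \<union> E. fst a = Suc d} = n"
        using Suc.prems p by simp
      then have "diagram_determined ((L - {p}) \<union> E)"
      proof (intro Suc.IH)
        show "finite (L - {p} \<union> E)" using E(1) Suc.prems(1) by simp
        show "poly_coeffs a" "fst a \<le> Suc d" if "a \<in> L - {p} \<union> E" for a
          using that E(2) Suc.prems(2,3)[of a] le_SucI by blast+
      qed
      then show ?case using E by blast
    qed
    then show ?case using Suc.prems by blast
  qed
  have "fst a \<le> Max (fst ` L)" if "a \<in> L" for a using that assms(1) by simp
  then show ?thesis using main assms by blast
qed

section \<open>Semialgebraic sets as unions of sign cells; elimination of variables\<close>

lemma semialgebraic_UNIV: "semialgebraic UNIV"
  using sa_pos[OF pf_const[of 1]] by simp

lemma semialgebraic_Int: "semialgebraic A \<Longrightarrow> semialgebraic B \<Longrightarrow> semialgebraic (A \<inter> B)"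
  using sa_compl[OF sa_union[OF sa_compl[of A] sa_compl[of B]]] by simp

lemma semialgebraic_Union:
  assumes "finite C" "\<And>S. S \<in> C \<Longrightarrow> semialgebraic S"
  shows "semialgebraic (\<Union>C)"
  using assms
proof (induction rule: finite_induct)
  case empty
  then show ?case using sa_compl[OF semialgebraic_UNIV] by simp
qed (auto intro: sa_union)

lemma semialgebraic_Inter:
  assumes "finite C" "\<And>S. S \<in> C \<Longrightarrow> semialgebraic S"
  shows "semialgebraic (\<Inter>C)"
  using assms
  by (induction rule: finite_induct) (auto intro: semialgebraic_UNIV semialgebraic_Int)

lemma semialgebraic_sgn_eq:
  assumes "poly_fun p"
  shows "semialgebraic {y. sgn (p y) = sgn (c::real)}"
proof -
  have "{y. sgn (p y) = sgn c} = (if c = 0 then {y. p y = 0} else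
      if 0 < c then {y. 0 < p y} else - ({y. 0 < p y} \<union> {y. p y = 0}))"
    by (auto simp: sgn_if split: if_splits)
  moreover have "semialgebraic (- ({y. 0 < p y} \<union> {y. p y = 0}))"
    using assms by (intro sa_compl sa_union sa_pos sa_zero)
  ultimately show ?thesis using sa_pos[OF assms] sa_zero[OF assms] by presburger
qed

definition sgn_cell :: "('c \<Rightarrow> real) set \<Rightarrow> 'c \<Rightarrow> 'c set" where
  "sgn_cell A y = {y'. sgn_equiv A y y'}"

lemma finite_sgn_cells: "finite A \<Longrightarrow> finite (range (sgn_cell A))"
proof -
  assume A: "finite A"
  have sgn_real: "sgn x \<in> {-1, 0, 1}" for x :: real
    by (cases x "0::real" rule: linorder_cases) auto
  define G where "G y = (\<lambda>f. if f \<in> A then sgn (f y) else 0)" for y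
  have "range G \<subseteq> {g. \<forall>f. (f \<in> A \<longrightarrow> g f \<in> {-1, 0, 1}) \<and> (f \<notin> A \<longrightarrow> g f = 0)}"
    unfolding G_def using sgn_real by (simp add: image_subset_iff del: insert_iff)
  moreover have "finite {g. \<forall>f. (f \<in> A \<longrightarrow> g f \<in> {-1, 0, 1::real}) \<and> (f \<notin> A \<longrightarrow> g f = 0)}"
    using A by (intro finite_set_of_finite_funs) auto
  ultimately have "finite (range G)" using finite_subset by blast
  moreover have "sgn_cell A y = (\<lambda>g. {y'. \<forall>f\<in>A. g f = sgn (f y')}) (G y)" for y
    by (simp add: sgn_cell_def sgn_equiv_def G_def)
  then have "range (sgn_cell A) = (\<lambda>g. {y'. \<forall>f\<in>A. g f = sgn (f y')}) ` range G"
    by (auto simp: image_iff)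
  ultimately show ?thesis by simp
qed

lemma semialgebraic_sgn_cell:
  assumes "finite A" "\<And>f. f \<in> A \<Longrightarrow> poly_fun f"
  shows "semialgebraic (sgn_cell A y)"
proof -
  have "sgn_cell A y = (\<Inter>f\<in>A. {y'. sgn (f y') = sgn (f y)})"
    by (auto simp: sgn_cell_def sgn_equiv_def)
  then show ?thesis using assms by (auto intro!: semialgebraic_Inter semialgebraic_sgn_eq)
qed

text \<open>Finitely many polynomials have only finitely many sign cells, and the condition says
  that \<open>S\<close> is a union of such cells. It serves as the normal form of semialgebraic
  sets.\<close>

lemma semialgebraic_iff_sgn:
  "semialgebraic S \<longleftrightarrow> (\<exists>A. finite A \<and> (\<forall>f\<in>A. poly_fun f) \<and>
     (\<forall>y y'. sgn_equiv A y y' \<longrightarrow> y \<in> S \<longrightarrow> y' \<in> S))"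
proof
  assume "semialgebraic S"
  then show "\<exists>A. finite A \<and> (\<forall>f\<in>A. poly_fun f) \<and> (\<forall>y y'. sgn_equiv A y y' \<longrightarrow> y \<in> S \<longrightarrow> y' \<in> S)"
  proof induction
    case (sa_pos p)
    then show ?case by (intro exI[of _ "{p}"]) (auto simp: sgn_equiv_def sgn_if split: if_splits)
  next
    case (sa_zero p)
    then show ?case by (intro exI[of _ "{p}"]) (auto simp: sgn_equiv_def sgn_if split: if_splits)
  next
    case (sa_compl S)
    then obtain A where A: "finite A" "\<forall>f\<in>A. poly_fun f"
      "\<forall>y y'. sgn_equiv A y y' \<longrightarrow> y \<in> S \<longrightarrow> y' \<in> S" by blast
    have "sgn_equiv A y' y" if "sgn_equiv A y y'" for y y'
      using that by (simp add: sgn_equiv_def)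
    then show ?case using A by (intro exI[of _ A]) blast
  next
    case (sa_union S T)
    then obtain A B where
      A: "finite A" "\<forall>f\<in>A. poly_fun f" "\<forall>y y'. sgn_equiv A y y' \<longrightarrow> y \<in> S \<longrightarrow> y' \<in> S" and
      B: "finite B" "\<forall>f\<in>B. poly_fun f" "\<forall>y y'. sgn_equiv B y y' \<longrightarrow> y \<in> T \<longrightarrow> y' \<in> T"
      by blast
    have "sgn_equiv A y y'" "sgn_equiv B y y'" if "sgn_equiv (A \<union> B) y y'" for y y'
      using that by (auto simp: sgn_equiv_def)
    then show ?case using A B by (intro exI[of _ "A \<union> B"]) blast
  qed
next
  assume "\<exists>A. finite A \<and> (\<forall>f\<in>A. poly_fun f) \<and> (\<forall>y y'. sgn_equiv A y y' \<longrightarrow> y \<in> S \<longrightarrow> y' \<in> S)"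
  then obtain A where A: "finite A" "\<forall>f\<in>A. poly_fun f"
    "\<And>y y'. sgn_equiv A y y' \<Longrightarrow> y \<in> S \<Longrightarrow> y' \<in> S" by blast
  have "S = \<Union>(sgn_cell A ` S)"
    using A(3) by (auto simp: sgn_cell_def sgn_equiv_def)
  moreover have "finite (sgn_cell A ` S)"
    using finite_sgn_cells[OF A(1)] by (rule finite_subset[rotated]) blast
  then have "semialgebraic (\<Union>(sgn_cell A ` S))"
    using A semialgebraic_sgn_cell by (intro semialgebraic_Union) blast+
  ultimately show "semialgebraic S" by simp
qed

lemma semialgebraic_vimage:
  assumes "semialgebraic S" "\<And>b. b \<in> Basis \<Longrightarrow> poly_fun (\<lambda>x. f x \<bullet> b)"
  shows "semialgebraic {x. f x \<in> S}"
  using assms(1)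
proof induction
  case (sa_pos p)
  then show ?case using semialgebraic.sa_pos[OF poly_fun_compose[OF sa_pos assms(2)]] by simp
next
  case (sa_zero p)
  then show ?case using semialgebraic.sa_zero[OF poly_fun_compose[OF sa_zero assms(2)]] by simp
next
  case (sa_compl A)
  then show ?case using semialgebraic.sa_compl[of "{x. f x \<in> A}"] by (simp add: Collect_neg_eq)
next
  case (sa_union A B)
  then show ?case using semialgebraic.sa_union[of "{x. f x \<in> A}" "{x. f x \<in> B}"]
    by (simp add: Collect_disj_eq)
qed

lemma semialgebraic_vimage_linear:
  assumes "semialgebraic S" "linear f"
  shows "semialgebraic {x. f x \<in> S}"
  using assms(1)
proof (rule semialgebraic_vimage)
  fix b
  show "poly_fun (\<lambda>x. f x \<bullet> b)"
    using poly_fun_compose_linear[OF poly_fun_inner assms(2)] .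
qed

lemma poly_fun_along_line:
  assumes "poly_fun p"
  shows "\<exists>a. poly_coeffs a \<and> (\<forall>z t. p (z + t *\<^sub>R v) = poly (at_param a z) t)"
proof -
  have "\<exists>N Q. (\<forall>i. poly_fun (\<lambda>z. coeff (Q z) i)) \<and> (\<forall>z. \<forall>i\<ge>N. coeff (Q z) i = 0) \<and>
      (\<forall>z t. p (z + t *\<^sub>R v) = poly (Q z) t)"
    using assms
  proof induction
    case (pf_const c)
    show ?case
      by (rule exI[of _ 1], rule exI[of _ "\<lambda>z. [:c:]"])
        (auto simp: coeff_pCons split: nat.split intro: poly_fun.pf_const)
  next
    case (pf_coord b)
    have "poly_fun (\<lambda>z. coeff [:z \<bullet> b, v \<bullet> b:] i)" for i
    proof -
      consider "i = 0" | "i = 1" | j where "i = Suc (Suc j)" by (metis One_nat_def not0_implies_Suc)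
      then show ?thesis by cases (auto intro: poly_fun.pf_const poly_fun.pf_coord pf_coord)
    qed
    then show ?case
      by (intro exI[of _ 2] exI[of _ "\<lambda>z. [:z \<bullet> b, v \<bullet> b:]"])
        (auto simp: coeff_pCons inner_add_left split: nat.split)
  next
    case (pf_add p q)
    then obtain N Q N' Q' where
      "\<forall>i. poly_fun (\<lambda>z. coeff (Q z) i)" "\<forall>z. \<forall>i\<ge>N. coeff (Q z) i = 0"
      "\<forall>z t. p (z + t *\<^sub>R v) = poly (Q z) t"
      "\<forall>i. poly_fun (\<lambda>z. coeff (Q' z) i)" "\<forall>z. \<forall>i\<ge>N'. coeff (Q' z) i = 0"
      "\<forall>z t. q (z + t *\<^sub>R v) = poly (Q' z) t" by blast
    then show ?case
      by (intro exI[of _ "max N N'"] exI[of _ "\<lambda>z. Q z + Q' z"]) (auto intro: poly_fun.pf_add)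
  next
    case (pf_mult p q)
    then obtain N Q N' Q' where Q:
      "\<forall>i. poly_fun (\<lambda>z. coeff (Q z) i)" "\<forall>z. \<forall>i\<ge>N. coeff (Q z) i = 0"
      "\<forall>z t. p (z + t *\<^sub>R v) = poly (Q z) t"
      "\<forall>i. poly_fun (\<lambda>z. coeff (Q' z) i)" "\<forall>z. \<forall>i\<ge>N'. coeff (Q' z) i = 0"
      "\<forall>z t. q (z + t *\<^sub>R v) = poly (Q' z) t" by blast
    have "coeff (Q z * Q' z) i = 0" if "i \<ge> N + N'" for z i
      unfolding coeff_mult
    proof (rule sum.neutral, rule ballI)
      fix j assume "j \<in> {..i}"
      then have "j \<ge> N \<or> i - j \<ge> N'" using that by auto
      then show "coeff (Q z) j * coeff (Q' z) (i - j) = 0" using Q(2,5) by auto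
    qed
    moreover have "poly_fun (\<lambda>z. coeff (Q z * Q' z) i)" for i
      unfolding coeff_mult using Q(1,4) by (intro poly_fun_sum poly_fun.pf_mult) auto
    ultimately show ?case using Q(3,6)
      by (intro exI[of _ "N + N'"] exI[of _ "\<lambda>z. Q z * Q' z"]) auto
  qed
  then obtain N Q where Q: "\<forall>i. poly_fun (\<lambda>z. coeff (Q z) i)" "\<forall>z. \<forall>i\<ge>N. coeff (Q z) i = 0"
      "\<forall>z t. p (z + t *\<^sub>R v) = poly (Q z) t" by blast
  have "at_param (N, \<lambda>i z. coeff (Q z) i) z = Q z" for z
    using Q(2) by (intro poly_eqI) (simp add: coeff_at_param)
  then show ?thesis using Q
    by (intro exI[of _ "(N, \<lambda>i z. coeff (Q z) i)"]) (simp add: poly_coeffs_def)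
qed

text \<open>A witness \<open>t\<close> over \<open>z\<close> is carried to the witness
  \<open>\<phi> t\<close> over \<open>z'\<close> by the bijection that matches the sign diagrams
  along the two lines. The union of lines stays in the same space, so that several directions can be
  eliminated in turn.\<close>

lemma semialgebraic_ex_line:
  fixes S :: "'c::euclidean_space set"
  assumes "semialgebraic S"
  shows "semialgebraic {z. \<exists>t. z + t *\<^sub>R v \<in> S}"
proof -
  obtain A where A: "finite A" "\<forall>f\<in>A. poly_fun f"
    "\<And>y y'. sgn_equiv A y y' \<Longrightarrow> y \<in> S \<Longrightarrow> y' \<in> S"
    using assms unfolding semialgebraic_iff_sgn by blast
  have "\<forall>f\<in>A. \<exists>a. poly_coeffs a \<and> (\<forall>z t. f (z + t *\<^sub>R v) = poly (at_param a z) t)"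
    using A(2) poly_fun_along_line by blast
  then obtain a where a: "\<And>f. f \<in> A \<Longrightarrow> poly_coeffs (a f)"
    "\<And>f z t. f \<in> A \<Longrightarrow> f (z + t *\<^sub>R v) = poly (at_param (a f) z) t" by metis
  have "diagram_determined (a ` A)" using A(1) a(1) by (intro diagram_determined) auto
  then obtain B where B: "finite B" "\<forall>f\<in>B. poly_fun f"
    "\<And>z z'. sgn_equiv B z z' \<Longrightarrow> \<exists>\<phi>. same_diagram (a ` A) z z' \<phi>"
    unfolding diagram_determined_def by blast
  have "\<exists>t'. z' + t' *\<^sub>R v \<in> S" if eq: "sgn_equiv B z z'" and mem: "z + t *\<^sub>R v \<in> S" for z z' t
  proof -
    obtain \<phi> where "same_diagram (a ` A) z z' \<phi>" using B(3)[OF eq] by blast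
    then have "sgn_equiv A (z + t *\<^sub>R v) (z' + \<phi> t *\<^sub>R v)"
      using a(2) unfolding same_diagram_def sgn_equiv_def by simp
    then show ?thesis using A(3) mem by blast
  qed
  then show ?thesis unfolding semialgebraic_iff_sgn using B(1,2) by (intro exI[of _ B]) blast
qed

text \<open>The Tarski-Seidenberg theorem. The set is saturated along each basis direction of the
  second factor; the slice at \<open>0\<close> of the result is the projection.\<close>

theorem semialgebraic_projection:
  fixes S :: "('a::euclidean_space \<times> 'b::euclidean_space) set"
  assumes "semialgebraic S"
  shows "semialgebraic {x. \<exists>y. (x, y) \<in> S}"
proof -
  have "semialgebraic {z. \<exists>c. z + (\<Sum>b\<in>B. c b *\<^sub>R (0, b)) \<in> S}" if "finite B" for B :: "'b set"
    using that
  proof (induction B rule: finite_induct)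
    case empty
    then show ?case using assms by simp
  next
    case (insert b B)
    have "{z. \<exists>c. z + (\<Sum>b\<in>insert b B. c b *\<^sub>R (0, b)) \<in> S} =
        {z. \<exists>t. z + t *\<^sub>R (0, b) \<in> {z. \<exists>c. z + (\<Sum>b\<in>B. c b *\<^sub>R (0, b)) \<in> S}}" (is "?L = ?R")
    proof (intro equalityI subsetI)
      fix z assume "z \<in> ?L"
      then show "z \<in> ?R" using insert.hyps by (auto simp: add.assoc)
    next
      fix z assume "z \<in> ?R"
      then obtain t c where "z + t *\<^sub>R (0, b) + (\<Sum>b\<in>B. c b *\<^sub>R (0, b)) \<in> S" by blast

      moreover have "(\<Sum>b'\<in>B. (c(b := t)) b' *\<^sub>R (0::'a, b')) = (\<Sum>b'\<in>B. c b' *\<^sub>R (0, b'))"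
        by (rule sum.cong) (use insert.hyps in auto)
      ultimately have "z + (\<Sum>b'\<in>insert b B. (c(b := t)) b' *\<^sub>R (0, b')) \<in> S"
        using insert.hyps by (simp add: add.assoc)
      then show "z \<in> ?L" by blast
    qed
    then show ?case using semialgebraic_ex_line[OF insert.IH, of "(0, b)"] by simp
  qed
  then have "semialgebraic {z. \<exists>c. z + (\<Sum>b\<in>Basis. c b *\<^sub>R (0, b)) \<in> S}" by simp
  then have "semialgebraic {x. (x, 0) \<in> {z. \<exists>c. z + (\<Sum>b\<in>Basis. c b *\<^sub>R (0, b)) \<in> S}}"
    by (rule semialgebraic_vimage_linear) (auto intro!: linearI)
  moreover have "(\<exists>c. (x, 0) + (\<Sum>b\<in>Basis. c b *\<^sub>R (0, b)) \<in> S) \<longleftrightarrow> (\<exists>y. (x, y) \<in> S)" for x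
  proof
    have sum: "(x, 0) + (\<Sum>b\<in>Basis. c b *\<^sub>R (0, b)) = (x, \<Sum>b\<in>Basis. c b *\<^sub>R b)" for c :: "'b \<Rightarrow> real"
      by (simp add: sum_prod prod_eq_iff fst_sum snd_sum)
    show "\<exists>y. (x, y) \<in> S" if "\<exists>c. (x, 0) + (\<Sum>b\<in>Basis. c b *\<^sub>R (0, b)) \<in> S"
      using that unfolding sum by blast
    show "\<exists>c. (x, 0) + (\<Sum>b\<in>Basis. c b *\<^sub>R (0, b)) \<in> S" if ex: "\<exists>y. (x, y) \<in> S"
    proof -
      obtain y where "(x, y) \<in> S" using ex by blast
      then show ?thesis unfolding sum
        by (intro exI[of _ "\<lambda>b. y \<bullet> b"]) (simp add: euclidean_representation)
    qed
  qed
  ultimately show ?thesis by simp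
qed

section \<open>Lojasiewicz inequality and open semialgebraic sets\<close>

lemma poly_fun_real_imp_poly:
  assumes "poly_fun (f :: real \<Rightarrow> real)"
  shows "\<exists>A. f = poly A"
  using assms
proof induction
  case (pf_const c)
  show ?case by (rule exI[of _ "[:c:]"]) auto
next
  case (pf_coord b)
  then show ?case by (intro exI[of _ "[:0, 1:]"]) auto
next
  case (pf_add p q)
  then obtain A B where "p = poly A" "q = poly B" by blast
  then show ?case by (intro exI[of _ "A + B"]) auto
next
  case (pf_mult p q)
  then obtain A B where "p = poly A" "q = poly B" by blast
  then show ?case by (intro exI[of _ "A * B"]) auto
qed

lemma poly_lower_bound_near_0:
  fixes A :: "real poly"
  assumes "A \<noteq> 0"
  shows "\<exists>M s0. 0 < s0 \<and> (\<forall>s. 0 < s \<longrightarrow> s < s0 \<longrightarrow> s ^ M \<le> \<bar>poly A s\<bar>)"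
  using assms
proof (induction A rule: pCons_induct)
  case (pCons a A)
  show ?case
  proof (cases "a = 0")
    case True
    then obtain M s0 where M: "0 < s0" "\<And>s. 0 < s \<Longrightarrow> s < s0 \<Longrightarrow> s ^ M \<le> \<bar>poly A s\<bar>"
      using pCons by auto
    then have "s ^ Suc M \<le> \<bar>poly (pCons a A) s\<bar>" if "0 < s" "s < s0" for s
      using that True by (simp add: abs_mult)
    then show ?thesis using M(1) by blast
  next
    case False
    have "isCont (poly (pCons a A)) 0" by simp
    then obtain d where d: "d > 0" "\<And>s. \<bar>s\<bar> < d \<Longrightarrow> \<bar>poly (pCons a A) s - a\<bar> < \<bar>a\<bar> / 2"
    proof -
      have "\<exists>d>0. \<forall>s. dist s 0 < d \<longrightarrow> dist (poly (pCons a A) s) (poly (pCons a A) 0) < \<bar>a\<bar> / 2"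
        using \<open>isCont (poly (pCons a A)) 0\<close> False unfolding continuous_at_eps_delta
        by (metis half_gt_zero zero_less_abs_iff)
      then show thesis using that by (auto simp: dist_real_def)
    qed
    have "s ^ 1 \<le> \<bar>poly (pCons a A) s\<bar>" if "0 < s" "s < min d (\<bar>a\<bar> / 2)" for s
      using d(2)[of s] that by (simp only: power_one_right) linarith
    then show ?thesis using d(1) False
      by (intro exI[of _ 1] exI[of _ "min d (\<bar>a\<bar> / 2)"]) auto
  qed
qed simp

text \<open>The first coefficient that is not the zero polynomial dominates. It is at least
  \<open>s ^ M\<close> in modulus, while for \<open>t < s ^ Suc M\<close> and
  \<open>s < 1 / K\<close> the remaining terms, bounded by \<open>t * K\<close>, stay below that.
  Leading zero coefficients are removed by dividing by \<open>t > 0\<close>.\<close>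

lemma sgn_const_near_axis_aux:
  fixes C :: "nat \<Rightarrow> real poly"
  shows "\<exists>N s0. 0 < s0 \<and> (\<forall>s t t'. 0 < s \<longrightarrow> s < s0 \<longrightarrow> 0 < t \<longrightarrow> t < s ^ N \<longrightarrow> 0 < t' \<longrightarrow> t' < s ^ N \<longrightarrow>
    sgn (\<Sum>i<n. poly (C i) s * t ^ i) = sgn (\<Sum>i<n. poly (C i) s * t' ^ i))"
proof (induction n arbitrary: C)
  case 0
  show ?case by (rule exI[of _ 0], rule exI[of _ 1]) auto
next
  case (Suc n)
  define g where "g s t = (\<Sum>i<n. poly (C (Suc i)) s * t ^ i)" for s t
  have split: "(\<Sum>i<Suc n. poly (C i) s * t ^ i) = poly (C 0) s + t * g s t" for s t
    by (subst sum.lessThan_Suc_shift) (simp add: g_def sum_distrib_left mult_ac)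
  show ?case
  proof (cases "C 0 = 0")
    case True
    obtain N s0 where N: "0 < s0" "\<And>s t t'. 0 < s \<Longrightarrow> s < s0 \<Longrightarrow> 0 < t \<Longrightarrow> t < s ^ N \<Longrightarrow>
        0 < t' \<Longrightarrow> t' < s ^ N \<Longrightarrow> sgn (g s t) = sgn (g s t')"
      using Suc.IH[of "\<lambda>i. C (Suc i)"] unfolding g_def by blast
    have "sgn (poly (C 0) s + t * g s t) = sgn (poly (C 0) s + t' * g s t')"
      if "0 < s" "s < s0" "0 < t" "t < s ^ N" "0 < t'" "t' < s ^ N" for s t t'
      using N(2)[OF that] that True by (simp add: sgn_mult)
    then show ?thesis unfolding split using N(1) by blast
  next
    case False
    obtain M s1 where M: "0 < s1" "\<And>s. 0 < s \<Longrightarrow> s < s1 \<Longrightarrow> s ^ M \<le> \<bar>poly (C 0) s\<bar>"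
      using poly_lower_bound_near_0[OF False] by blast
    have "continuous_on ({0..1} \<times> {0..1}) (\<lambda>x. g (fst x) (snd x))"
      unfolding g_def by (intro continuous_intros)
    then have "bounded ((\<lambda>x. g (fst x) (snd x)) ` ({0..1} \<times> {0..1}))"
      by (intro compact_imp_bounded compact_continuous_image compact_Times) auto
    then obtain K where K: "K > 0" "\<And>s t. 0 \<le> s \<Longrightarrow> s \<le> 1 \<Longrightarrow> 0 \<le> t \<Longrightarrow> t \<le> 1 \<Longrightarrow> \<bar>g s t\<bar> \<le> K"
      unfolding bounded_pos by auto
    define s0 where "s0 = min s1 (min 1 (1 / K))"
    have sg: "sgn (poly (C 0) s + t * g s t) = sgn (poly (C 0) s)"
      if s: "0 < s" "s < s0" and t: "0 < t" "t < s ^ Suc M" for s t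
    proof -
      have "s ^ Suc M \<le> 1" using s by (intro power_le_one) (auto simp: s0_def)
      then have "\<bar>g s t\<bar> \<le> K" using K(2)[of s t] s t by (simp add: s0_def)
      then have "\<bar>t * g s t\<bar> \<le> t * K" using t by (simp add: abs_mult mult_left_mono)
      also have "\<dots> < s ^ Suc M * K" using t K(1) by (intro mult_strict_right_mono)
      also have "\<dots> = s ^ M * (s * K)" by simp
      also have "\<dots> \<le> s ^ M * 1"
        using s K(1) by (intro mult_left_mono) (auto simp: s0_def field_simps)
      also have "\<dots> \<le> \<bar>poly (C 0) s\<bar>" using M(2)[of s] s by (simp add: s0_def)
      finally show ?thesis by (auto simp: sgn_if abs_if split: if_splits)
    qed
    have "0 < s0" using M(1) K(1) by (simp add: s0_def)
    then show ?thesis unfolding split using sg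
      by (intro exI[of _ "Suc M"] exI[of _ s0]) simp
  qed
qed

lemma poly_fun_sgn_const_near_axis:
  fixes p :: "real \<times> real \<Rightarrow> real"
  assumes "poly_fun p"
  shows "\<exists>N s0. 0 < s0 \<and> (\<forall>s t t'. 0 < s \<longrightarrow> s < s0 \<longrightarrow> 0 < t \<longrightarrow> t < s ^ N \<longrightarrow> 0 < t' \<longrightarrow> t' < s ^ N \<longrightarrow>
    sgn (p (s, t)) = sgn (p (s, t')))"
proof -
  obtain a where a: "poly_coeffs a" "\<And>z t. p (z + t *\<^sub>R (0, 1)) = poly (at_param a z) t"
    using poly_fun_along_line[OF assms, of "(0, 1)"] by blast
  have "\<exists>A. (\<lambda>s. snd a i (s, 0)) = poly A" for i
  proof (rule poly_fun_real_imp_poly)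
    have "linear (\<lambda>s::real. (s, 0::real))" by (auto intro!: linearI)
    then show "poly_fun (\<lambda>s. snd a i (s, 0))"
      using a(1) poly_fun_compose_linear unfolding poly_coeffs_def by blast
  qed
  then obtain C where C: "\<And>i. (\<lambda>s. snd a i (s, 0)) = poly (C i)" by metis
  have "p (s, t) = (\<Sum>i<fst a. poly (C i) s * t ^ i)" for s t
    using a(2)[of "(s, 0)" t] C by (simp add: at_param_def poly_sum poly_monom fun_eq_iff)
  then show ?thesis using sgn_const_near_axis_aux[of C "fst a"] by simp
qed

text \<open>Membership depends only on signs, which do not change for \<open>0 < e < s ^ N\<close>.
  Avoiding \<open>W\<close> for arbitrarily small \<open>e\<close>, with a threshold depending on
  \<open>s\<close> in an unknown way, thus propagates to a whole cusp.\<close>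

lemma semialgebraic_avoids_cusp:
  fixes W :: "(real \<times> real) set"
  assumes "semialgebraic W" and near: "\<And>s. 0 < s \<Longrightarrow> \<exists>v>0. \<forall>e. 0 < e \<longrightarrow> e < v \<longrightarrow> (s, e) \<notin> W"
  shows "\<exists>N s0. odd N \<and> 0 < s0 \<and> (\<forall>s e. 0 < s \<longrightarrow> s < s0 \<longrightarrow> 0 < e \<longrightarrow> e < s ^ N \<longrightarrow> (s, e) \<notin> W)"
proof -
  obtain A where A: "finite A" "\<And>f. f \<in> A \<Longrightarrow> poly_fun f"
    "\<And>y y'. sgn_equiv A y y' \<Longrightarrow> y \<in> W \<Longrightarrow> y' \<in> W"
    using assms(1) unfolding semialgebraic_iff_sgn by blast
  have "\<exists>N s0. 0 < s0 \<and> (\<forall>f\<in>A. \<forall>s t t'. 0 < s \<longrightarrow> s < s0 \<longrightarrow> 0 < t \<longrightarrow> t < s ^ N \<longrightarrow> 0 < t' \<longrightarrow> t' < s ^ N \<longrightarrow>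
    sgn (f (s, t)) = sgn (f (s, t')))"
    using A(1,2)
  proof (induction A rule: finite_induct)
    case empty
    show ?case by (rule exI[of _ 0], rule exI[of _ 1]) simp
  next
    case (insert f A)
    obtain N s0 where N: "0 < s0" "\<And>g s t t'. g \<in> A \<Longrightarrow> 0 < s \<Longrightarrow> s < s0 \<Longrightarrow> 0 < t \<Longrightarrow> t < s ^ N \<Longrightarrow>
      0 < t' \<Longrightarrow> t' < s ^ N \<Longrightarrow> sgn (g (s, t)) = sgn (g (s, t'))"
    proof -
      have "\<And>g. g \<in> A \<Longrightarrow> poly_fun g" using insert.prems by blast
      then show thesis using insert.IH that by blast
    qed
    obtain N' s1 where N': "0 < s1" "\<And>s t t'. 0 < s \<Longrightarrow> s < s1 \<Longrightarrow> 0 < t \<Longrightarrow> t < s ^ N' \<Longrightarrow>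
      0 < t' \<Longrightarrow> t' < s ^ N' \<Longrightarrow> sgn (f (s, t)) = sgn (f (s, t'))"
      using poly_fun_sgn_const_near_axis[of f] insert.prems by blast
    have "sgn (g (s, t)) = sgn (g (s, t'))" if g: "g \<in> insert f A" and s: "0 < s" "s < min 1 (min s0 s1)"
      and t: "0 < t" "t < s ^ (N + N')" "0 < t'" "t' < s ^ (N + N')" for g s t t'
    proof -
      have "s ^ (N + N') \<le> s ^ N" "s ^ (N + N') \<le> s ^ N'"
        using s by (auto intro!: power_decreasing)
      then have "t < s ^ N" "t' < s ^ N" "t < s ^ N'" "t' < s ^ N'" "s < s0" "s < s1"
        using s t by linarith+
      then show ?thesis using N(2)[of g s t t'] N'(2)[of s t t'] g s t by blast
    qed
    moreover have "0 < min 1 (min s0 s1)" using N(1) N'(1) by simp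
    ultimately show ?case by blast
  qed
  then obtain N s0 where N: "0 < s0" "\<And>f s t t'. f \<in> A \<Longrightarrow> 0 < s \<Longrightarrow> s < s0 \<Longrightarrow> 0 < t \<Longrightarrow> t < s ^ N \<Longrightarrow>
      0 < t' \<Longrightarrow> t' < s ^ N \<Longrightarrow> sgn (f (s, t)) = sgn (f (s, t'))" by blast
  \<comment> \<open>As \<open>s < 1\<close>, passing from \<open>N\<close> to
    \<open>2 * N + 1\<close> only shrinks the cusp. Oddness later allows to read off the sign of a
    number from its \<open>N\<close>-th power and excludes \<open>N = 0\<close>.\<close>
  have "(s, e) \<notin> W" if s: "0 < s" "s < min 1 s0" and e: "0 < e" "e < s ^ (2 * N + 1)" for s e
  proof
    assume W: "(s, e) \<in> W"
    have sN: "s ^ (2 * N + 1) \<le> s ^ N" using s by (intro power_decreasing) auto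
    obtain v where v: "0 < v" "\<And>e. 0 < e \<Longrightarrow> e < v \<Longrightarrow> (s, e) \<notin> W" using near[OF s(1)] by blast
    define e' where "e' = min (v / 2) e"
    have e': "0 < e'" "e' < v" "e' < s ^ N" using v e sN by (auto simp: e'_def)
    have "sgn_equiv A (s, e) (s, e')"
      unfolding sgn_equiv_def
    proof
      fix f assume "f \<in> A"
      then show "sgn (f (s, e)) = sgn (f (s, e'))" using N(2)[of f s e e'] s e e' sN by linarith
    qed
    then show False using A(3) W v(2) e' by blast
  qed
  moreover have "0 < min 1 s0" using N(1) by simp
  ultimately show ?thesis by (intro exI[of _ "2 * N + 1"] exI[of _ "min 1 s0"]) auto
qed

lemma poly_fun_inner_self:
  fixes f :: "'a::euclidean_space \<Rightarrow> 'b::euclidean_space"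
  assumes "linear f"
  shows "poly_fun (\<lambda>y. f y \<bullet> f y)"
proof -
  have "(\<lambda>y. f y \<bullet> f y) = (\<lambda>y. \<Sum>b\<in>Basis. (f y \<bullet> b) * (f y \<bullet> b))"
    by (rule ext) (rule euclidean_inner)
  moreover have "poly_fun (\<lambda>y. \<Sum>b\<in>Basis. (f y \<bullet> b) * (f y \<bullet> b))"
    by (intro poly_fun_sum pf_mult poly_fun_compose_linear[OF poly_fun_inner assms])
  ultimately show ?thesis by simp
qed

lemma semialgebraic_nonneg: "poly_fun p \<Longrightarrow> semialgebraic {y. 0 \<le> p y}"
proof -
  assume p: "poly_fun p"
  have "{y. 0 \<le> p y} = {y. 0 < p y} \<union> {y. p y = 0}" by auto
  then show ?thesis using p sa_union sa_pos sa_zero by metis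
qed

lemma linear_fst: "linear fst" and linear_snd: "linear snd"
  by (auto intro!: linearI)

lemma poly_fun_fst: "poly_fun p \<Longrightarrow> poly_fun (\<lambda>x. p (fst x))"
  and poly_fun_snd: "poly_fun p \<Longrightarrow> poly_fun (\<lambda>x. p (snd x))"
  using poly_fun_compose_linear[of p fst] poly_fun_compose_linear[of p snd] linear_fst linear_snd by auto

lemma poly_fun_id: "poly_fun (\<lambda>x::real. x)"
  by (intro poly_fun_linear linear_ident)

text \<open>One parameter \<open>s\<close> bounds \<open>\<theta> x\<close> below by
  \<open>s\<close> and \<open>norm x\<close> above by \<open>1 / s\<close>. Each slice is then
  compact, so \<open>f\<close> has a positive minimum on it, and \<open>W\<close>, a projection, is
  semialgebraic: by \<open>semialgebraic_avoids_cusp\<close> that minimum cannot decay faster than a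
  power of \<open>s\<close>. The weight on the right records the price for unbounded
  \<open>x\<close>.\<close>

lemma lojasiewicz_inequality:
  fixes f \<theta> :: "'a::euclidean_space \<Rightarrow> real"
  assumes K: "closed K" "semialgebraic K"
    and cont: "continuous_on UNIV f" "continuous_on UNIV \<theta>"
    and nonneg: "\<And>x. 0 \<le> f x" and zero: "\<And>x. x \<in> K \<Longrightarrow> f x = 0 \<Longrightarrow> \<theta> x \<le> 0"
    and sa: "semialgebraic {(x, e). f x \<le> e}" "semialgebraic {(x, s). s \<le> \<theta> x}"
  shows "\<exists>N B. odd N \<and> 0 < B \<and>
    (\<forall>x\<in>K. 0 < \<theta> x \<longrightarrow> \<theta> x ^ N \<le> f x * (1 + \<theta> x * (B + norm x)) ^ N)"
proof -
  define T where "T = {((s, e), x). x \<in> K \<and> f x \<le> e \<and> s \<le> \<theta> x \<and> s\<^sup>2 * (x \<bullet> x) \<le> 1}"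
  define W where "W = {se. \<exists>x. (se, x) \<in> T}"
  have "semialgebraic {y::(real \<times> real) \<times> 'a. snd y \<in> K}"
    using semialgebraic_vimage_linear[OF K(2) linear_snd] .
  moreover have "semialgebraic {y::(real \<times> real) \<times> 'a. (snd y, snd (fst y)) \<in> {(x, e). f x \<le> e}}"
    by (rule semialgebraic_vimage_linear[OF sa(1)]) (auto intro!: linearI)
  moreover have "semialgebraic {y::(real \<times> real) \<times> 'a. (snd y, fst (fst y)) \<in> {(x, s). s \<le> \<theta> x}}"
    by (rule semialgebraic_vimage_linear[OF sa(2)]) (auto intro!: linearI)
  moreover have "semialgebraic {y::(real \<times> real) \<times> 'a. 0 \<le> 1 - (fst (fst y))\<^sup>2 * (snd y \<bullet> snd y)}"
    by (intro semialgebraic_nonneg poly_fun_diff pf_const pf_mult poly_fun_power poly_fun_inner_self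
        linear_snd poly_fun_fst[OF poly_fun_fst[OF poly_fun_id]])
  moreover have "T = {y. snd y \<in> K} \<inter> {y. (snd y, snd (fst y)) \<in> {(x, e). f x \<le> e}} \<inter>
      {y. (snd y, fst (fst y)) \<in> {(x, s). s \<le> \<theta> x}} \<inter> {y. 0 \<le> 1 - (fst (fst y))\<^sup>2 * (snd y \<bullet> snd y)}"
    by (auto simp: T_def)
  ultimately have "semialgebraic T" by (simp only: semialgebraic_Int)
  then have "semialgebraic W" unfolding W_def by (rule semialgebraic_projection)
  moreover have "\<exists>v>0. \<forall>e. 0 < e \<longrightarrow> e < v \<longrightarrow> (s, e) \<notin> W" if s: "0 < s" for s
  proof -
    define C where "C = K \<inter> {x. s \<le> \<theta> x} \<inter> {x. s\<^sup>2 * (x \<bullet> x) \<le> 1}"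
    have "closed C" unfolding C_def using cont
      by (intro closed_Int K(1) closed_Collect_le continuous_intros)
    moreover have "C \<subseteq> cball 0 (1 / s)"
    proof
      fix x assume "x \<in> C"
      then have "(s * norm x)\<^sup>2 \<le> 1\<^sup>2" by (simp add: C_def power_mult_distrib power2_norm_eq_inner)
      then have "s * norm x \<le> 1" by (rule power2_le_imp_le) simp
      then show "x \<in> cball 0 (1 / s)" using s by (simp add: field_simps)
    qed
    ultimately have "compact C" using bounded_subset bounded_cball compact_eq_bounded_closed by blast
    have W: "(s, e) \<in> W \<longleftrightarrow> (\<exists>x\<in>C. f x \<le> e)" for e by (auto simp: W_def T_def C_def)
    show ?thesis
    proof (cases "C = {}")
      case True
      then show ?thesis using W by (auto intro: exI[of _ 1])
    next
      case False
      then obtain x0 where x0: "x0 \<in> C" "\<And>x. x \<in> C \<Longrightarrow> f x0 \<le> f x"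
        using continuous_attains_inf[OF \<open>compact C\<close>, of f] cont(1) continuous_on_subset by blast
      have "f x0 \<noteq> 0" using zero[of x0] x0(1) s by (auto simp: C_def)
      then have "0 < f x0" using nonneg[of x0] by simp
      then show ?thesis using W x0(2) by (intro exI[of _ "f x0"]) force
    qed
  qed
  ultimately obtain N s0 where N: "odd N" "0 < s0"
    "\<And>s e. 0 < s \<Longrightarrow> s < s0 \<Longrightarrow> 0 < e \<Longrightarrow> e < s ^ N \<Longrightarrow> (s, e) \<notin> W"
    using semialgebraic_avoids_cusp[of W] by blast
  define B where "B = 2 / s0"
  have B: "0 < B" using N(2) by (simp add: B_def)
  have "\<theta> x ^ N \<le> f x * (1 + \<theta> x * (B + norm x)) ^ N" if x: "x \<in> K" and th: "0 < \<theta> x" for x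
  proof -
    define D where "D = 1 + \<theta> x * (B + norm x)"
    \<comment> \<open>Equivalently \<open>1 / s = 1 / \<theta> x + B + norm x\<close>, which makes
      \<open>s\<close> small enough for all three demands at once:
      \<open>s \<le> \<theta> x\<close>, \<open>s < s0\<close> and
      \<open>s * norm x \<le> 1\<close>.\<close>
    define s where "s = \<theta> x / D"
    have D1: "1 \<le> D" using th B by (simp add: D_def)
    have s0: "0 < s" using th D1 by (simp add: s_def)
    have s1: "s \<le> \<theta> x" using th D1 by (simp add: s_def divide_le_eq mult_le_cancel_left1)
    have sD: "s * D = \<theta> x" using D1 by (simp add: s_def)
    have "s < s0"
    proof -
      have "\<theta> x < s0 * (1 + \<theta> x * (B + norm x))"
      proof -
        have "s0 * (\<theta> x * B) = 2 * \<theta> x" using N(2) by (simp add: B_def)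
        moreover have "0 \<le> s0 * (\<theta> x * norm x)" using N(2) th by simp
        moreover have "s0 * (1 + \<theta> x * (B + norm x)) = s0 + s0 * (\<theta> x * B) + s0 * (\<theta> x * norm x)"
          by (simp add: algebra_simps)
        ultimately show ?thesis using N(2) th by linarith
      qed
      then show ?thesis using D1 by (simp add: s_def divide_less_eq D_def)
    qed
    have "s * norm x \<le> 1"
    proof -
      have "\<theta> x * norm x \<le> D" using th B by (simp add: D_def algebra_simps)
      then show ?thesis using D1 by (simp add: s_def divide_le_eq)
    qed
    then have s2: "s\<^sup>2 * (x \<bullet> x) \<le> 1"
      using s0 power_le_one[of "s * norm x" 2] by (simp add: power_mult_distrib power2_norm_eq_inner)
    have "s ^ N \<le> f x"
    proof (rule ccontr)
      assume "\<not> s ^ N \<le> f x"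
      \<comment> \<open>A value strictly above \<open>f x\<close> is taken because
        \<open>f x\<close> may be \<open>0\<close>, whereas the cusp only concerns
        \<open>e > 0\<close>.\<close>
      then obtain e where e: "f x < e" "e < s ^ N" using dense by (meson not_le)
      then have "(s, e) \<in> W" using x s1 s2 by (auto simp: W_def T_def)
      moreover have "0 < e" using nonneg[of x] e by linarith
      ultimately show False using N(3) s0 \<open>s < s0\<close> e by blast
    qed
    then have "s ^ N * D ^ N \<le> f x * D ^ N" using D1 by (intro mult_right_mono) auto
    then show ?thesis using sD by (simp add: D_def flip: power_mult_distrib)
  qed
  then show ?thesis using N(1) B by blast
qed

section \<open>ISD functions: continuity, semialgebraicity, closure properties\<close>

lemma poly_fun_continuous: "poly_fun p \<Longrightarrow> continuous_on UNIV p"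
  by (induction rule: poly_fun.induct) (auto intro!: continuous_intros)

lemma isd_continuous: "isd f \<Longrightarrow> continuous_on UNIV f"
  by (induction rule: isd.induct) (auto intro!: continuous_on_min continuous_on_max intro: poly_fun_continuous)

lemma isd_semialgebraic:
  assumes "isd f"
  shows "semialgebraic {(x, e). f x \<le> e}" "semialgebraic {(x, e). e \<le> f x}"
proof -
  have "semialgebraic {(x, e). f x \<le> e} \<and> semialgebraic {(x, e). e \<le> f x}"
    using assms
  proof induction
    case (isd_poly p)
    have "semialgebraic {y. 0 \<le> snd y - p (fst y)}" "semialgebraic {y. 0 \<le> p (fst y) - snd y}"
      using poly_fun_fst[OF isd_poly] poly_fun_snd[OF poly_fun_id]
      using semialgebraic_nonneg poly_fun_diff by blast+
    then show ?case by (simp add: case_prod_unfold)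
  next
    case (isd_min f g)
    have "{(x, e). min (f x) (g x) \<le> e} = {(x, e). f x \<le> e} \<union> {(x, e). g x \<le> e}"
      "{(x, e). e \<le> min (f x) (g x)} = {(x, e). e \<le> f x} \<inter> {(x, e). e \<le> g x}" by auto
    then show ?case using isd_min by (simp add: sa_union semialgebraic_Int)
  next
    case (isd_max f g)
    have "{(x, e). max (f x) (g x) \<le> e} = {(x, e). f x \<le> e} \<inter> {(x, e). g x \<le> e}"
      "{(x, e). e \<le> max (f x) (g x)} = {(x, e). e \<le> f x} \<union> {(x, e). e \<le> g x}" by auto
    then show ?case using isd_max by (simp add: sa_union semialgebraic_Int)
  qed
  then show "semialgebraic {(x, e). f x \<le> e}" "semialgebraic {(x, e). e \<le> f x}" by auto
qed

lemma isd_Min: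
  assumes "finite G" "G \<noteq> {}" "\<And>g. g \<in> G \<Longrightarrow> isd (h g)"
  shows "isd (\<lambda>x. Min ((\<lambda>g. h g x) ` G))"
  using assms
proof (induction G rule: finite_ne_induct)
  case (insert g G)
  then have "isd (\<lambda>x. min (h g x) (Min ((\<lambda>g. h g x) ` G)))" by (intro isd_min) auto
  then show ?case using insert by simp
qed simp

lemma isd_Max:
  assumes "finite G" "G \<noteq> {}" "\<And>g. g \<in> G \<Longrightarrow> isd (h g)"
  shows "isd (\<lambda>x. Max ((\<lambda>g. h g x) ` G))"
  using assms
proof (induction G rule: finite_ne_induct)
  case (insert g G)
  then have "isd (\<lambda>x. max (h g x) (Max ((\<lambda>g. h g x) ` G)))" by (intro isd_max) auto
  then show ?case using insert by simp
qed simp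

lemma isd_compose_linear: "isd f \<Longrightarrow> linear l \<Longrightarrow> isd (\<lambda>x. f (l x))"
  by (induction rule: isd.induct) (auto intro: isd.intros poly_fun_compose_linear)

lemma isd_minus: "isd f \<Longrightarrow> isd (\<lambda>x. - f x)"
proof (induction rule: isd.induct)
  case (isd_poly p)
  then show ?case using poly_fun_cmult[of p "-1"] isd.isd_poly by auto
qed (simp_all add: minus_min_eq_max minus_max_eq_min isd.isd_min isd.isd_max)

lemma isd_add: "isd f \<Longrightarrow> isd g \<Longrightarrow> isd (\<lambda>x. f x + g x)"
proof (induction rule: isd.induct)
  case (isd_poly p)
  show ?case using isd_poly(2)
  proof (induction rule: isd.induct)
    case (isd_poly q)
    then show ?case using \<open>poly_fun p\<close> by (intro isd.isd_poly pf_add)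
  qed (simp_all add: min_add_distrib_right max_add_distrib_right isd.isd_min isd.isd_max)
qed (simp_all add: min_add_distrib_left max_add_distrib_left isd.isd_min isd.isd_max)

lemma isd_mult_poly:
  assumes "isd f" "poly_fun p" "\<And>x. 0 \<le> p x"
  shows "isd (\<lambda>x. p x * f x)"
  using assms(1)
proof induction
  case (isd_poly q)
  then show ?case using assms(2) by (intro isd.isd_poly pf_mult)
qed (simp_all add: assms(3) min_mult_distrib_left max_mult_distrib_left not_less isd.isd_min isd.isd_max)

lemma le_1_plus_square: "t \<le> 1 + t\<^sup>2" for t :: real
proof -
  have "2 * t \<le> t\<^sup>2 + 1" using zero_le_power2[of "t - 1"] by (simp add: power2_diff)
  then show ?thesis using zero_le_power2[of t] by linarith
qed

lemma norm_le_1_plus_inner: "norm x \<le> 1 + x \<bullet> x"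
  using le_1_plus_square[of "norm x"] by (simp add: power2_norm_eq_inner)

text \<open>
  On the complement of \<open>U\<close> the Lojasiewicz inequality bounds the inequalities that define the
  cell by its equation, hence \<open>g ^ N - f * \<Psi>\<close> cannot be positive there for all of them.
\<close>

lemma isd_positive_on_cell:
  fixes U :: "'a::euclidean_space set"
  assumes U: "open U" "semialgebraic U"
    and A: "finite A" "\<And>f. f \<in> A \<Longrightarrow> poly_fun f" and cell: "sgn_cell A y \<subseteq> U"
  shows "\<exists>h. isd h \<and> (\<forall>x\<in>sgn_cell A y. 0 < h x) \<and> (\<forall>x. 0 < h x \<longrightarrow> x \<in> U)"
proof -
  define f where "f x = (\<Sum>a\<in>{a\<in>A. a y = 0}. (a x)\<^sup>2)" for x
  \<comment> \<open>The constant \<open>1\<close> keeps \<open>G\<close> nonempty when the cell has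
    no strict inequalities, and it caps \<open>\<theta>\<close> at \<open>1\<close>.\<close>
  define G where "G = insert (\<lambda>x. 1) ((\<lambda>a x. sgn (a y) * a x) ` {a\<in>A. a y \<noteq> 0})"
  define \<theta> where "\<theta> x = Min ((\<lambda>g. g x) ` G)" for x
  have f: "poly_fun f" unfolding f_def using A(2) by (intro poly_fun_sum poly_fun_power) auto
  have G: "finite G" "G \<noteq> {}" "\<And>g. g \<in> G \<Longrightarrow> poly_fun g"
    using A by (auto simp: G_def intro: pf_const poly_fun_cmult)
  have th: "isd \<theta>" unfolding \<theta>_def using G by (intro isd_Min isd_poly)
  have nonneg: "0 \<le> f x" for x unfolding f_def by (intro sum_nonneg) simp
  have f0: "f x = 0 \<longleftrightarrow> (\<forall>a\<in>A. a y = 0 \<longrightarrow> a x = 0)" for x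
    unfolding f_def using A(1) by (subst sum_nonneg_eq_0_iff) auto
  have thpos: "0 < \<theta> x \<longleftrightarrow> (\<forall>a\<in>A. a y \<noteq> 0 \<longrightarrow> 0 < sgn (a y) * a x)" for x
    unfolding \<theta>_def using G(1,2) by (subst Min_gr_iff) (auto simp: G_def)
  have cell_iff: "x \<in> sgn_cell A y \<longleftrightarrow> f x = 0 \<and> 0 < \<theta> x" for x
  proof -
    have "sgn (a y) = sgn (a x) \<longleftrightarrow> (a y = 0 \<longrightarrow> a x = 0) \<and> (a y \<noteq> 0 \<longrightarrow> 0 < sgn (a y) * a x)"
      for a :: "'a \<Rightarrow> real"
      by (cases "a y" "0::real" rule: linorder_cases; cases "a x" "0::real" rule: linorder_cases) auto
    then show ?thesis unfolding sgn_cell_def sgn_equiv_def f0 thpos by auto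
  qed
  have "\<exists>N B. odd N \<and> 0 < B \<and>
    (\<forall>x\<in>- U. 0 < \<theta> x \<longrightarrow> \<theta> x ^ N \<le> f x * (1 + \<theta> x * (B + norm x)) ^ N)"
  proof (rule lojasiewicz_inequality)
    show "\<theta> x \<le> 0" if "x \<in> - U" "f x = 0" for x
      using that cell_iff[of x] cell by (meson ComplD not_le subsetD)
    show "closed (- U)" using U(1) by (rule closed_Compl)
    show "semialgebraic (- U)" using U(2) by (rule sa_compl)
    show "continuous_on UNIV f" "continuous_on UNIV \<theta>"
      by (intro isd_continuous isd_poly f th)+
    show "semialgebraic {(x, e). f x \<le> e}" by (intro isd_semialgebraic isd_poly f)
    show "semialgebraic {(x, s). s \<le> \<theta> x}" by (intro isd_semialgebraic th)
  qed (fact nonneg)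
  then obtain N B where N: "odd N" "0 < B"
    "\<And>x. x \<notin> U \<Longrightarrow> 0 < \<theta> x \<Longrightarrow> \<theta> x ^ N \<le> f x * (1 + \<theta> x * (B + norm x)) ^ N" by auto
  \<comment> \<open>A polynomial majorant of the weight
    \<open>(1 + \<theta> x * (B + norm x)) ^ N\<close>, from \<open>\<theta> x \<le> 1\<close> and
    \<open>norm x \<le> 1 + x \<bullet> x\<close>. The weight itself is not polynomial.\<close>
  define \<Psi> where "\<Psi> x = (1 + (B + 1 + x \<bullet> x)) ^ N" for x :: 'a
  have Psi: "poly_fun \<Psi>" unfolding \<Psi>_def
    by (intro poly_fun_power pf_add pf_const poly_fun_inner_self linear_ident)
  have Psi0: "0 \<le> \<Psi> x" for x unfolding \<Psi>_def using N(2) by (intro zero_le_power) simp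
  define h where "h x = Min ((\<lambda>g. g x ^ N - f x * \<Psi> x) ` G)" for x
  have "isd h" unfolding h_def
    using G f Psi by (intro isd_Min isd_poly poly_fun_diff poly_fun_power pf_mult) auto
  moreover have hpos: "0 < h x \<longleftrightarrow> (\<forall>g\<in>G. f x * \<Psi> x < g x ^ N)" for x
    unfolding h_def using G(1,2) by (subst Min_gr_iff) auto
  have "0 < h x" if "x \<in> sgn_cell A y" for x
  proof -
    have "f x = 0" "0 < \<theta> x" using that cell_iff by auto
    moreover have "0 < g x" if "g \<in> G" for g
    proof -
      have "\<theta> x \<le> g x" unfolding \<theta>_def using G(1) that by (intro Min_le) auto
      then show ?thesis using \<open>0 < \<theta> x\<close> by simp
    qed
    ultimately show ?thesis unfolding hpos by simp
  qed
  moreover have "x \<in> U" if "0 < h x" for x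
  proof (rule ccontr)
    assume "x \<notin> U"
    have "\<theta> x \<in> (\<lambda>g. g x) ` G" unfolding \<theta>_def using G(1,2) by (intro Min_in) auto
    then have gt: "f x * \<Psi> x < \<theta> x ^ N" using that unfolding hpos by auto
    moreover have "0 \<le> f x * \<Psi> x" using nonneg Psi0 by simp
    ultimately have "0 < \<theta> x ^ N" by linarith
    then have pos: "0 < \<theta> x" using N(1) unfolding zero_less_power_eq by (cases N) auto
    have "\<theta> x \<le> 1" unfolding \<theta>_def using G(1) by (intro Min_le) (auto simp: G_def)
    have "norm x \<le> 1 + x \<bullet> x" by (rule norm_le_1_plus_inner)
    then have "\<theta> x * (B + norm x) \<le> 1 * (B + 1 + x \<bullet> x)"
      using pos \<open>\<theta> x \<le> 1\<close> N(2) by (intro mult_mono) auto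
    then have "(1 + \<theta> x * (B + norm x)) ^ N \<le> \<Psi> x"
      unfolding \<Psi>_def using pos N(2) by (intro power_mono) auto
    then have "f x * (1 + \<theta> x * (B + norm x)) ^ N \<le> f x * \<Psi> x"
      using nonneg by (intro mult_left_mono)
    then show False using N(3)[OF \<open>x \<notin> U\<close> pos] gt by linarith
  qed
  ultimately show ?thesis by blast
qed

text \<open>\<open>U\<close> is a finite union of sign cells. The functions of
  \<open>isd_positive_on_cell\<close> are positive on their cell and nowhere outside
  \<open>U\<close>, so their maximum has positivity set exactly \<open>U\<close>.\<close>

theorem open_semialgebraic_isd:
  fixes U :: "'a::euclidean_space set"
  assumes "open U" "semialgebraic U"
  shows "\<exists>h. isd h \<and> U = {x. 0 < h x}"
proof (cases "U = {}")
  case True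
  then show ?thesis by (intro exI[of _ "\<lambda>x. 0"]) (auto intro: isd_poly pf_const)
next
  case False
  obtain A where A: "finite A" "\<And>f. f \<in> A \<Longrightarrow> poly_fun f"
    "\<And>y y'. sgn_equiv A y y' \<Longrightarrow> y \<in> U \<Longrightarrow> y' \<in> U"
    using assms(2) unfolding semialgebraic_iff_sgn by blast
  define C where "C = sgn_cell A ` U"
  have C: "finite C" "C \<noteq> {}"
    using finite_subset[OF _ finite_sgn_cells[OF A(1)], of C] False by (auto simp: C_def)
  have "\<forall>c\<in>C. \<exists>h. isd h \<and> (\<forall>x\<in>c. 0 < h x) \<and> (\<forall>x. 0 < h x \<longrightarrow> x \<in> U)"
  proof
    fix c assume "c \<in> C"
    then obtain y where y: "y \<in> U" "c = sgn_cell A y" unfolding C_def by blast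
    have "sgn_cell A y \<subseteq> U" using A(3) y(1) unfolding sgn_cell_def by blast
    then show "\<exists>h. isd h \<and> (\<forall>x\<in>c. 0 < h x) \<and> (\<forall>x. 0 < h x \<longrightarrow> x \<in> U)"
      unfolding y(2) using assms A(1,2) by (intro isd_positive_on_cell)
  qed
  then obtain h where h: "\<And>c. c \<in> C \<Longrightarrow> isd (h c)" "\<And>c x. c \<in> C \<Longrightarrow> x \<in> c \<Longrightarrow> 0 < h c x"
    "\<And>c x. c \<in> C \<Longrightarrow> 0 < h c x \<Longrightarrow> x \<in> U" by metis
  have "isd (\<lambda>x. Max ((\<lambda>c. h c x) ` C))" using C h(1) by (intro isd_Max)
  moreover have "0 < Max ((\<lambda>c. h c x) ` C) \<longleftrightarrow> x \<in> U" for x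
  proof -
    have "0 < Max ((\<lambda>c. h c x) ` C) \<longleftrightarrow> (\<exists>c\<in>C. 0 < h c x)"
      using C by (subst Max_gr_iff) auto
    also have "\<dots> \<longleftrightarrow> x \<in> U"
    proof
      assume "x \<in> U"
      then have "sgn_cell A x \<in> C" "x \<in> sgn_cell A x"
        by (auto simp: C_def sgn_cell_def sgn_equiv_def)
      then show "\<exists>c\<in>C. 0 < h c x" using h(2) by blast
    qed (use h(3) in blast)
    finally show ?thesis .
  qed
  ultimately show ?thesis by (intro exI[of _ "\<lambda>x. Max ((\<lambda>c. h c x) ` C)"]) auto
qed

text \<open>The positive parts of the two ISD functions are supported on opposite sides of the
  graph, so their difference \<open>h\<close> has the right sign. The Lojasiewicz inequality,
  applied on the whole space with \<open>\<theta>\<close> the distance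
  \<open>\<bar>F x - y\<bar>\<close>, then bounds \<open>\<bar>h\<bar>\<close> below up to a weight,
  which is absorbed into \<open>H\<close>.\<close>

lemma isd_restoring_field:
  fixes F :: "'a::euclidean_space \<Rightarrow> real"
  assumes cont: "continuous_on UNIV F" and bound: "\<And>x. \<bar>F x\<bar> < u"
    and sa: "semialgebraic {(x, y). y < F x}" "semialgebraic {(x, y). F x < y}"
  shows "\<exists>N H. odd N \<and> isd H \<and> (\<forall>x y. \<bar>F x - y\<bar> ^ N \<le> \<bar>H (x, y)\<bar> \<and> sgn (H (x, y)) = sgn (F x - y))"
proof -
  have contF: "continuous_on UNIV (\<lambda>z::'a \<times> real. F (fst z))"
    by (rule continuous_on_compose2[OF cont]) (auto intro: continuous_intros)
  have "open {z. snd z < F (fst z)}" "open {z. F (fst z) < snd z}"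
    using contF by (auto intro!: open_Collect_less continuous_intros)
  moreover have "semialgebraic {z. snd z < F (fst z)}" "semialgebraic {z. F (fst z) < snd z}"
    using sa by (simp_all add: case_prod_unfold)
  ultimately obtain hA hB where hA: "isd hA" "{z. snd z < F (fst z)} = {z. 0 < hA z}"
    and hB: "isd hB" "{z. F (fst z) < snd z} = {z. 0 < hB z}"
    using open_semialgebraic_isd[of "{z. snd z < F (fst z)}"] open_semialgebraic_isd[of "{z. F (fst z) < snd z}"]
    by blast
  define h where "h z = max (hA z) 0 + - max (hB z) 0" for z
  have h: "isd h" unfolding h_def
    by (intro isd_add isd_minus isd_max hA(1) hB(1) isd_poly[OF pf_const])
  have iff: "0 < hA z \<longleftrightarrow> snd z < F (fst z)" "0 < hB z \<longleftrightarrow> F (fst z) < snd z" for z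
    using hA(2) hB(2) by (auto simp: set_eq_iff)
  have sgn_h: "sgn (h z) = sgn (F (fst z) - snd z)" for z
    using iff[of z] by (auto simp: h_def sgn_if max_def)
  define \<theta> where "\<theta> z = \<bar>F (fst z) - snd z\<bar>" for z
  have "isd (\<lambda>z. max (h z) (- h z))" using h by (intro isd_max isd_minus)
  moreover have "max (h z) (- h z) = \<bar>h z\<bar>" for z by linarith
  ultimately have habs: "isd (\<lambda>z. \<bar>h z\<bar>)" by simp
  have "\<exists>N B. odd N \<and> 0 < B \<and>
    (\<forall>z\<in>UNIV. 0 < \<theta> z \<longrightarrow> \<theta> z ^ N \<le> \<bar>h z\<bar> * (1 + \<theta> z * (B + norm z)) ^ N)"
  proof (rule lojasiewicz_inequality)
    show "continuous_on UNIV \<theta>" unfolding \<theta>_def using contF by (intro continuous_intros)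
    show "\<theta> z \<le> 0" if "\<bar>h z\<bar> = 0" for z
      using sgn_h[of z] that by (simp add: \<theta>_def sgn_0_0)
    have "linear (\<lambda>w::('a \<times> real) \<times> real. (fst (fst w), snd (fst w) + snd w))"
      "linear (\<lambda>w::('a \<times> real) \<times> real. (fst (fst w), snd (fst w) - snd w))"
      by (auto intro!: linearI simp: algebra_simps)
    \<comment> \<open>\<open>s \<le> \<bar>F x - y\<bar>\<close> means
      \<open>y + s \<le> F x\<close> or \<open>F x \<le> y - s\<close>, which are linear preimages
      of the complements of the given sets.\<close>
    then have "semialgebraic ({w::('a \<times> real) \<times> real. (fst (fst w), snd (fst w) + snd w) \<in> - {(x, y). F x < y}} \<union>
      {w::('a \<times> real) \<times> real. (fst (fst w), snd (fst w) - snd w) \<in> - {(x, y). y < F x}})"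
      using sa by (intro sa_union semialgebraic_vimage_linear sa_compl)
    also have "\<dots> = {(z, s). s \<le> \<theta> z}" by (auto simp: \<theta>_def)
    finally show "semialgebraic {(z, s). s \<le> \<theta> z}" .
    show "closed (UNIV :: ('a \<times> real) set)" "semialgebraic (UNIV :: ('a \<times> real) set)"
      by (simp_all add: semialgebraic_UNIV)
    show "continuous_on UNIV (\<lambda>z. \<bar>h z\<bar>)" by (intro isd_continuous habs)
    show "semialgebraic {(z, e). \<bar>h z\<bar> \<le> e}" by (intro isd_semialgebraic habs)
  qed simp
  then obtain N B where N: "odd N" "0 < B"
    "\<And>z. 0 < \<theta> z \<Longrightarrow> \<theta> z ^ N \<le> \<bar>h z\<bar> * (1 + \<theta> z * (B + norm z)) ^ N" by auto
  \<comment> \<open>\<open>F\<close> is not polynomial, but bounded by \<open>u\<close>: hence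
    \<open>\<theta> z \<le> u + \<bar>y\<bar> \<le> u + 1 + y\<^sup>2\<close> for
    \<open>y = snd z\<close>, and the weight again has a polynomial majorant.\<close>
  define \<Psi> where "\<Psi> z = (1 + (u + 1 + (snd z)\<^sup>2) * (B + 1 + z \<bullet> z)) ^ N" for z :: "'a \<times> real"
  have upos: "0 < u" using bound[of undefined] by linarith
  have base: "1 \<le> 1 + (u + 1 + (snd z)\<^sup>2) * (B + 1 + z \<bullet> z)" for z :: "'a \<times> real"
    using upos N(2) by simp
  have Psi: "poly_fun \<Psi>" unfolding \<Psi>_def
    by (intro poly_fun_power pf_add pf_mult pf_const poly_fun_inner_self linear_ident
        poly_fun_snd[OF poly_fun_id])
  have Psi0: "1 \<le> \<Psi> z" for z unfolding \<Psi>_def using base by (intro one_le_power)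
  define H where "H z = \<Psi> z * h z" for z
  have "isd H" unfolding H_def
    using h Psi Psi0 by (intro isd_mult_poly) (auto intro: order_trans[OF zero_le_one])
  moreover have "sgn (H z) = sgn (F (fst z) - snd z)" for z
    using Psi0[of z] sgn_h[of z] by (simp add: H_def sgn_mult)
  moreover have "\<theta> z ^ N \<le> \<bar>H z\<bar>" for z
  proof (cases "\<theta> z = 0")
    case True
    then show ?thesis using N(1) by (cases N) auto
  next
    case False
    then have pos: "0 < \<theta> z" by (simp add: \<theta>_def)
    have "norm z \<le> 1 + z \<bullet> z" by (rule norm_le_1_plus_inner)
    moreover have "\<theta> z \<le> u + 1 + (snd z)\<^sup>2"
      using bound[of "fst z"] le_1_plus_square[of "\<bar>snd z\<bar>"] by (simp add: \<theta>_def)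
    ultimately have "\<theta> z * (B + norm z) \<le> (u + 1 + (snd z)\<^sup>2) * (B + 1 + z \<bullet> z)"
      using pos N(2) by (intro mult_mono) auto
    then have "(1 + \<theta> z * (B + norm z)) ^ N \<le> \<Psi> z"
      unfolding \<Psi>_def using pos N(2) by (intro power_mono) auto
    then have "\<bar>h z\<bar> * (1 + \<theta> z * (B + norm z)) ^ N \<le> \<bar>h z\<bar> * \<Psi> z"
      by (intro mult_left_mono) auto
    also have "\<dots> = \<bar>H z\<bar>" using Psi0[of z] by (simp add: H_def abs_mult)
    finally show ?thesis using N(3)[OF pos] by linarith
  qed
  ultimately show ?thesis using N(1) by (intro exI[of _ N] exI[of _ H]) (auto simp: \<theta>_def)
qed

section \<open>The clamped differential equation\<close>

lemma integral_has_derivative_halfline: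
  fixes g :: "real \<Rightarrow> real"
  assumes "continuous_on UNIV g" "0 \<le> t"
  shows "((\<lambda>u. integral {0..u} g) has_real_derivative g t) (at t within {0..})"
proof -
  have "((\<lambda>u. integral {0..u} g) has_vector_derivative g t) (at t within {0..t+1})"
    using assms by (intro integral_has_vector_derivative) (auto intro: continuous_on_subset)
  moreover have "at t within {0..t+1} = at t within {0..}"
    using assms by (intro at_within_nhd[of t "{..<t+1}"]) auto
  ultimately show ?thesis by (simp add: has_real_derivative_iff_has_vector_derivative)
qed

text \<open>Picard-Lindeloef on a half-line by one application of Banach's fixed point theorem. The
  unknown is \<open>w t = exp (- 2 * L * t) * y t\<close>; in the supremum norm of \<open>w\<close>
  the Picard operator has contraction constant \<open>1/2\<close>, and the bound on \<open>G\<close>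
  makes its values bounded functions.\<close>

lemma global_lipschitz_ode_solution:
  fixes G :: "real \<Rightarrow> real \<Rightarrow> real"
  assumes cont: "continuous_on UNIV (\<lambda>p. G (fst p) (snd p))"
    and bound: "\<And>t y. \<bar>G t y\<bar> \<le> c"
    and lip: "\<And>t y y'. \<bar>G t y - G t y'\<bar> \<le> L * \<bar>y - y'\<bar>" and L: "0 < L"
  shows "\<exists>y. y 0 = 0 \<and> (\<forall>t\<ge>0. (y has_real_derivative G t (y t)) (at t within {0..}))"
proof -
  define g where "g w r = G r (exp (2 * L * r) * w r)" for w r
  have g_cont: "continuous_on UNIV (g w)" if "continuous_on UNIV w" for w
  proof -
    have "continuous_on UNIV (\<lambda>r. (r, exp (2 * L * r) * w r))"
      using that by (intro continuous_intros)
    from continuous_on_compose2[OF cont this] show ?thesis unfolding g_def by simp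
  qed
  have int: "g w integrable_on {0..t}" if "continuous_on UNIV w" for w t
    using g_cont[OF that] by (intro integrable_continuous_real) (auto intro: continuous_on_subset)
  \<comment> \<open>\<open>max 0 t\<close> continues the operator constantly to negative times,
    since bounded continuous functions are taken on the whole line.\<close>
  define T where "T w t = exp (- (2 * L * max 0 t)) * integral {0..max 0 t} (g w)" for w t
  have c0: "0 \<le> c" using bound[of 0 0] by linarith
  have T_bcontfun: "T w \<in> bcontfun" if w: "continuous_on UNIV w" for w
  proof (rule bcontfun_normI)
    have "continuous_on {0..} (\<lambda>u. integral {0..u} (g w))"
      using integral_has_derivative_halfline[OF g_cont[OF w]]
      by (intro DERIV_continuous_on) auto
    then have "continuous_on UNIV (\<lambda>t. integral {0..max 0 t} (g w))"
      by (rule continuous_on_compose2) (auto intro!: continuous_intros)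
    then show "continuous_on UNIV (T w)" unfolding T_def by (intro continuous_intros)
    show "norm (T w t) \<le> c / (2 * L)" for t
    proof -
      define m where "m = max 0 t"
      have m: "0 \<le> m" by (simp add: m_def)
      have "norm (integral {0..m} (g w)) \<le> c * (m - 0)"
        using m g_cont[OF w] bound
        by (intro integral_bound) (auto intro: continuous_on_subset simp: g_def)
      then have "norm (T w t) \<le> exp (- (2 * L * m)) * (c * m)"
        by (simp add: T_def abs_mult mult_left_mono flip: m_def)
      also have "\<dots> \<le> c / (2 * L)"
      proof -
        have "2 * L * m \<le> exp (2 * L * m)" using exp_ge_add_one_self[of "2 * L * m"] by linarith
        then have "c * (2 * L * m) \<le> c * exp (2 * L * m)" using c0 by (rule mult_left_mono)
        then show ?thesis using L by (simp add: exp_minus field_simps)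
      qed
      finally show ?thesis .
    qed
  qed
  define \<T> where "\<T> (w :: real \<Rightarrow>\<^sub>C real) = Bcontfun (T (apply_bcontfun w))" for w
  have app: "apply_bcontfun (\<T> w) = T (apply_bcontfun w)" for w
    unfolding \<T>_def by (rule Bcontfun_inverse) (intro T_bcontfun continuous_on_apply_bcontfun)
  have "dist (\<T> w) (\<T> v) \<le> 1 / 2 * dist w v" for w v
  proof (rule dist_bound)
    fix t :: real
    define m where "m = max 0 t"
    have m: "0 \<le> m" by (simp add: m_def)
    have expint: "((\<lambda>r. L * exp (2 * L * r) * dist w v) has_integral
        (exp (2 * L * m) / 2 * dist w v - exp (2 * L * 0) / 2 * dist w v)) {0..m}"
      by (intro fundamental_theorem_of_calculus m)
        (auto intro!: derivative_eq_intros simp flip: has_real_derivative_iff_has_vector_derivative)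
    have "integral {0..m} (g w) - integral {0..m} (g v) = integral {0..m} (\<lambda>r. g w r - g v r)"
      by (intro Henstock_Kurzweil_Integration.integral_diff[symmetric] int continuous_on_apply_bcontfun)
    also have "norm \<dots> \<le> integral {0..m} (\<lambda>r. L * exp (2 * L * r) * dist w v)"
    proof (rule integral_norm_bound_integral)
      show "(\<lambda>r. g w r - g v r) integrable_on {0..m}"
        by (intro integrable_diff int continuous_on_apply_bcontfun)
      show "(\<lambda>r. L * exp (2 * L * r) * dist w v) integrable_on {0..m}" using expint by blast
      fix r
      have "norm (g w r - g v r) \<le> L * \<bar>exp (2 * L * r) * w r - exp (2 * L * r) * v r\<bar>"
        unfolding g_def using lip by simp
      also have "\<dots> = L * exp (2 * L * r) * dist (w r) (v r)"
        by (simp add: dist_real_def abs_mult flip: right_diff_distrib)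
      also have "\<dots> \<le> L * exp (2 * L * r) * dist w v"
        using L by (intro mult_left_mono dist_bounded) auto
      finally show "norm (g w r - g v r) \<le> L * exp (2 * L * r) * dist w v" .
    qed
    also have "\<dots> \<le> exp (2 * L * m) * (1 / 2 * dist w v)"
      unfolding integral_unique[OF expint] by simp
    finally have "exp (- (2 * L * m)) * \<bar>integral {0..m} (g w) - integral {0..m} (g v)\<bar>
        \<le> exp (- (2 * L * m)) * (exp (2 * L * m) * (1 / 2 * dist w v))"
      by (intro mult_left_mono) auto
    also have "\<dots> = 1 / 2 * dist w v" by (simp add: exp_minus)
    finally show "dist (\<T> w t) (\<T> v t) \<le> 1 / 2 * dist w v"
      unfolding app T_def dist_real_def m_def[symmetric]
      by (simp add: abs_mult flip: right_diff_distrib)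
  qed
  then obtain w where w: "\<T> w = w"
    using banach_fix_type[of "1/2" \<T>] by auto
  define y where "y t = exp (2 * L * t) * w t" for t
  have y: "y t = integral {0..t} (g w)" if "0 \<le> t" for t
  proof -
    have "apply_bcontfun w t = T w t" using app[of w] w by simp
    then show ?thesis using that by (simp add: y_def T_def exp_minus)
  qed
  have "(y has_real_derivative G t (y t)) (at t within {0..})" if "0 \<le> t" for t
  proof -
    have "((\<lambda>u. integral {0..u} (g w)) has_real_derivative g w t) (at t within {0..})"
      using that by (intro integral_has_derivative_halfline g_cont continuous_on_apply_bcontfun)
    then have "(y has_real_derivative g w t) (at t within {0..})"
      by (rule has_field_derivative_transform_within[where d = 1]) (use that y in auto)
    then show ?thesis by (simp add: g_def y_def)
  qed
  moreover have "y 0 = 0" using y[of 0] by simp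
  ultimately show ?thesis by blast
qed

definition clampr :: "real \<Rightarrow> real \<Rightarrow> real" where
  "clampr c a = min (max a (- c)) c"

lemma clampr_scale: "0 < k \<Longrightarrow> k * clampr c a = clampr (k * c) (k * a)"
  by (simp add: clampr_def min_mult_distrib_left max_mult_distrib_left)

lemma clampr_lipschitz: "\<bar>clampr c a - clampr c b\<bar> \<le> \<bar>a - b\<bar>"
  unfolding clampr_def by linarith

lemma clampr_bound: "0 \<le> c \<Longrightarrow> \<bar>clampr c a\<bar> \<le> c"
  unfolding clampr_def by linarith

lemma clampr_id: "\<bar>a\<bar> \<le> c \<Longrightarrow> clampr c a = a"
  unfolding clampr_def by linarith

lemma at_within_unit_interval: "s < 1 \<Longrightarrow> at s within {0..<1} = at s within {0..1::real}"
  by (intro at_within_nhd[of s "{..<1}"]) auto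

text \<open>In the time \<open>\<tau> = 1 / (1 - s) ^ m - 1\<close> the right-hand side becomes globally Lipschitz,
  since the clamp commutes with the positive factor \<open>ds / d\<tau>\<close>.\<close>

lemma clamped_ode_solution:
  fixes h :: "real \<Rightarrow> real"
  assumes c: "0 < c" and L: "0 \<le> L" and m: "0 < m"
    and lip: "\<And>a b. \<bar>a\<bar> \<le> c \<Longrightarrow> \<bar>b\<bar> \<le> c \<Longrightarrow> \<bar>h a - h b\<bar> \<le> L * \<bar>a - b\<bar>"
  shows "\<exists>y. y 0 = 0 \<and> (\<forall>s\<in>{0..<1}.
    (y has_real_derivative clampr c (h (y s) / (1 - s) ^ Suc m)) (at s within {0..1}))"
proof -
  define q where "q t = root m (1 / (1 + max 0 t))" for t
  have q0: "0 < q t" for t unfolding q_def using m by simp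
  have q1: "q t \<le> 1" for t unfolding q_def using m by simp
  \<comment> \<open>Here \<open>q t\<close> is \<open>1 - s\<close> in the new time, and
    \<open>ds / d\<tau>\<close> is \<open>q t ^ Suc m / m\<close>. Multiplied into the clamp, it
    cancels the singular denominator and shrinks the clamping bound instead. The inner
    \<open>clampr c y\<close> turns the local Lipschitz bound for \<open>h\<close> into a global
    one.\<close>
  define G where "G t y = clampr (q t ^ Suc m * c / m) (h (clampr c y) / m)" for t y
  have lip': "\<bar>h (clampr c y) - h (clampr c y')\<bar> \<le> L * \<bar>y - y'\<bar>" for y y'
  proof -
    have "\<bar>h (clampr c y) - h (clampr c y')\<bar> \<le> L * \<bar>clampr c y - clampr c y'\<bar>"
      using c by (intro lip clampr_bound) auto
    also have "\<dots> \<le> L * \<bar>y - y'\<bar>" using L clampr_lipschitz by (intro mult_left_mono)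
    finally show ?thesis .
  qed
  have hcont: "continuous_on UNIV (\<lambda>y. h (clampr c y))"
  proof -
    have "L-lipschitz_on UNIV (\<lambda>y. h (clampr c y))"
      using lip' L by (intro lipschitz_onI) (auto simp: dist_real_def)
    then show ?thesis by (rule lipschitz_on_continuous_on)
  qed
  have "\<exists>Y. Y 0 = 0 \<and> (\<forall>t\<ge>0. (Y has_real_derivative G t (Y t)) (at t within {0..}))"
  proof (rule global_lipschitz_ode_solution)
    have hc2: "continuous_on UNIV (\<lambda>p::real \<times> real. h (clampr c (snd p)))"
      by (rule continuous_on_compose2[OF hcont]) (auto intro: continuous_intros)
    have qc: "continuous_on UNIV (\<lambda>p::real \<times> real. q (fst p))"
      unfolding q_def by (intro continuous_intros) auto
    show "continuous_on UNIV (\<lambda>p. G (fst p) (snd p))"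
      unfolding G_def clampr_def[of "q _ ^ _ * c / _"] using hc2 qc m by (intro continuous_intros) auto
    show "\<bar>G t y\<bar> \<le> c" for t y
    proof -
      have "q t ^ Suc m * c / m \<le> 1 * c / 1"
        using q0[of t] q1[of t] c m by (intro frac_le mult_right_mono power_le_one) auto
      moreover have "0 \<le> q t ^ Suc m * c / m" using q0[of t] c by simp
      ultimately show ?thesis unfolding G_def using clampr_bound order_trans by fastforce
    qed
    show "\<bar>G t y - G t y'\<bar> \<le> (L + 1) * \<bar>y - y'\<bar>" for t y y'
    proof -
      have "\<bar>G t y - G t y'\<bar> \<le> \<bar>h (clampr c y) / m - h (clampr c y') / m\<bar>"
        unfolding G_def by (rule clampr_lipschitz)
      also have "\<dots> = \<bar>h (clampr c y) - h (clampr c y')\<bar> / m"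
        by (simp flip: diff_divide_distrib)
      also have "\<dots> \<le> \<bar>h (clampr c y) - h (clampr c y')\<bar> / 1"
        using m by (intro divide_left_mono) auto
      also have "\<dots> \<le> (L + 1) * \<bar>y - y'\<bar>" using lip'[of y y'] by (simp add: algebra_simps)
      finally show ?thesis .
    qed
    show "0 < L + 1" using L by simp
  qed
  then obtain Y where Y: "Y 0 = 0" "\<And>t. 0 \<le> t \<Longrightarrow> (Y has_real_derivative G t (Y t)) (at t within {0..})"
    by blast
  define \<tau> where "\<tau> s = 1 / (1 - s) ^ m - 1" for s :: real
  define y where "y = Y \<circ> \<tau>"
  have tau0: "0 \<le> \<tau> s" if "s \<in> {0..<1}" for s
  proof -
    have "(1 - s) ^ m \<le> 1" using that by (intro power_le_one) auto
    then show ?thesis using that by (simp add: \<tau>_def)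
  qed
  have der: "(y has_real_derivative clampr c (h (clampr c (y s)) / (1 - s) ^ Suc m)) (at s within {0..<1})"
    if s: "s \<in> {0..<1}" for s
  proof -
    have q: "q (\<tau> s) = 1 - s"
      using tau0[OF s] s m by (simp add: q_def max_def) (simp add: \<tau>_def real_root_power_cancel)
    have "(\<tau> has_real_derivative m / (1 - s) ^ Suc m) (at s within {0..<1})"
    proof -
      define E where "E = (1 - s) ^ (m - 1)"
      have E: "(1 - s) ^ m = E * (1 - s)" "E \<noteq> 0"
        using power_minus_mult[OF m, of "1 - s"] s by (simp_all add: E_def)
      have "(\<tau> has_real_derivative (m * E) / ((1 - s) ^ m * (1 - s) ^ m)) (at s within {0..<1})"
        unfolding \<tau>_def E_def using s by (auto intro!: derivative_eq_intros)
      moreover have "(m * E) / ((1 - s) ^ m * (1 - s) ^ m) = m / (1 - s) ^ Suc m"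
        unfolding power_Suc E(1) using E(2) by simp
      ultimately show ?thesis by simp
    qed
    moreover have "(Y has_real_derivative G (\<tau> s) (Y (\<tau> s))) (at (\<tau> s) within \<tau> ` {0..<1})"
      using Y(2)[OF tau0[OF s]] by (rule DERIV_subset) (use tau0 in auto)
    ultimately have "(y has_real_derivative G (\<tau> s) (Y (\<tau> s)) * (m / (1 - s) ^ Suc m)) (at s within {0..<1})"
      unfolding y_def by (intro DERIV_image_chain)
    moreover have "G (\<tau> s) (Y (\<tau> s)) * (m / (1 - s) ^ Suc m) = clampr c (h (clampr c (y s)) / (1 - s) ^ Suc m)"
    proof -
      have "m / (1 - s) ^ Suc m * G (\<tau> s) (Y (\<tau> s)) =
          clampr (m / (1 - s) ^ Suc m * ((1 - s) ^ Suc m * c / m)) (m / (1 - s) ^ Suc m * (h (clampr c (y s)) / m))"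
        unfolding G_def q using s m by (subst clampr_scale) (auto simp: y_def)
      also have "m / (1 - s) ^ Suc m * ((1 - s) ^ Suc m * c / m) = c" using s m by simp
      also have "m / (1 - s) ^ Suc m * (h (clampr c (y s)) / m) = h (clampr c (y s)) / (1 - s) ^ Suc m"
        using s m by simp
      finally show ?thesis by (simp add: mult.commute)
    qed
    ultimately show ?thesis by simp
  qed
  have y0: "y 0 = 0" using Y(1) by (simp add: y_def \<tau>_def)
  have "\<bar>y s\<bar> \<le> c" if s: "s \<in> {0..<1}" for s
  proof -
    have "norm (y s - y 0) \<le> c * norm (s - 0)"
      using der s c by (intro field_differentiable_bound[where S = "{0..<1}"]) (auto simp: clampr_bound)
    also have "\<dots> \<le> c * 1" using s c by (intro mult_left_mono) auto
    finally show ?thesis using y0 by simp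
  qed
  then have "(y has_real_derivative clampr c (h (y s) / (1 - s) ^ Suc m)) (at s within {0..1})"
    if "s \<in> {0..<1}" for s
    using der[OF that] at_within_unit_interval[of s] that by (simp add: clampr_id)
  then show ?thesis using y0 by blast
qed

section \<open>Barriers and behaviour at the final time\<close>

lemma negative_invariant:
  fixes g :: "real \<Rightarrow> real"
  assumes der: "\<And>s. s \<in> {0..<1} \<Longrightarrow> (g has_real_derivative g' s) (at s within {0..1})"
    and "g 0 < 0" and inward: "\<And>s. s \<in> {0..<1} \<Longrightarrow> g s = 0 \<Longrightarrow> g' s < 0"
    and s1: "s1 \<in> {0..<1}"
  shows "g s1 < 0"
proof (rule ccontr)
  assume "\<not> g s1 < 0"
  have cont: "continuous_on {0..s1} g"
  proof (rule DERIV_continuous_on)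
    fix s assume "s \<in> {0..s1}"
    then have "(g has_real_derivative g' s) (at s within {0..1})" using s1 by (intro der) auto
    then show "(g has_real_derivative g' s) (at s within {0..s1})"
      by (rule DERIV_subset) (use s1 in auto)
  qed
  define S where "S = {0..s1} \<inter> g -` {0..}"
  have "closed S" unfolding S_def using cont by (rule continuous_closed_preimage) auto
  moreover have "s1 \<in> S" using \<open>\<not> g s1 < 0\<close> s1 by (auto simp: S_def)
  moreover have bdd: "bdd_below S" unfolding S_def by (intro bdd_belowI[of _ 0]) auto
  ultimately have "Inf S \<in> S" using closed_contains_Inf by blast
  define s0 where "s0 = Inf S"
  have s0: "0 \<le> s0" "s0 \<le> s1" "0 \<le> g s0" using \<open>Inf S \<in> S\<close> by (auto simp: S_def s0_def)
  have before: "g s < 0" if "0 \<le> s" "s < s0" for s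
  proof (rule ccontr)
    assume "\<not> g s < 0"
    then have "s \<in> S" using that s0 by (auto simp: S_def)
    then have "s0 \<le> s" unfolding s0_def using bdd by (intro cInf_lower)
    then show False using that by simp
  qed
  have pos: "0 < s0" using s0 \<open>g 0 < 0\<close> by (cases "s0 = 0") auto
  have "g s0 = 0"
  proof (rule ccontr)
    assume "g s0 \<noteq> 0"
    obtain t where "0 \<le> t" "t \<le> s0" "g t = 0"
      using IVT'[of g 0 0 s0] s0 \<open>g 0 < 0\<close> continuous_on_subset[OF cont, of "{0..s0}"] by auto
    then show False using before[of t] \<open>g s0 \<noteq> 0\<close> by (cases "t = s0") auto
  qed
  \<comment> \<open>At the first zero a negative derivative forces positive values just to the left,
    contrary to \<open>before\<close>.\<close>
  then have "g' s0 < 0" using inward s0 s1 by auto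
  then obtain d where d: "d > 0" "\<And>h. h > 0 \<Longrightarrow> s0 - h \<in> {0..1} \<Longrightarrow> h < d \<Longrightarrow> g s0 < g (s0 - h)"
    using has_real_derivative_neg_dec_left[OF der[of s0]] s0 s1 by auto
  define h where "h = min (d / 2) s0"
  have "g s0 < g (s0 - h)" using d pos s0 s1 by (intro d(2)) (auto simp: h_def)
  moreover have "g (s0 - h) < 0" using pos d(1) by (intro before) (auto simp: h_def)
  ultimately show False using \<open>g s0 = 0\<close> by simp
qed

text \<open>At a contact with the barrier \<open>u * (1 - s)\<^sup>2\<close> the field is saturated, so the distance to the
  target shrinks at speed \<open>2 * u + 1\<close>, faster than the barrier.\<close>

lemma clamped_ode_barrier:
  fixes f u :: real and h y :: "real \<Rightarrow> real"
  assumes f: "\<bar>f\<bar> < u"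
    and h: "\<And>y. \<bar>f - y\<bar> ^ N \<le> \<bar>h y\<bar>" "\<And>y. sgn (h y) = sgn (f - y)"
    and y0: "y 0 = 0"
    and der: "\<And>s. s \<in> {0..<1} \<Longrightarrow> (y has_real_derivative
       clampr (2 * u + 1) ((2 * u + 1) / u ^ N * h (y s) / (1 - s) ^ (2 * N))) (at s within {0..1})"
    and s: "s \<in> {0..<1}"
  shows "\<bar>y s - f\<bar> \<le> u * (1 - s)\<^sup>2"
proof -
  have u: "0 < u" using f by linarith
  \<comment> \<open>Contact gives
    \<open>\<bar>h (y s)\<bar> \<ge> (u * (1 - s)\<^sup>2) ^ N\<close>. Both factors of this power
    are cancelled by the gain, so the argument of the clamp has modulus at least
    \<open>2 * u + 1\<close>.\<close>
  have sat: "clampr (2 * u + 1) ((2 * u + 1) / u ^ N * h (y s) / (1 - s) ^ (2 * N)) = (2 * u + 1) * sgn (f - y s)"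
    if "s \<in> {0..<1}" "\<bar>f - y s\<bar> = u * (1 - s)\<^sup>2" for s
  proof -
    define a where "a = (2 * u + 1) / u ^ N * h (y s) / (1 - s) ^ (2 * N)"
    have pos: "0 < u ^ N" "0 < (1 - s) ^ (2 * N)" using u that by simp_all
    have "u ^ N * (1 - s) ^ (2 * N) \<le> \<bar>h (y s)\<bar>"
      using h(1)[of "y s"] that by (simp add: power_mult_distrib power_mult)
    then have "(2 * u + 1) * (u ^ N * (1 - s) ^ (2 * N)) \<le> (2 * u + 1) * \<bar>h (y s)\<bar>"
      using u by (intro mult_left_mono) auto
    then have "2 * u + 1 \<le> (2 * u + 1) * \<bar>h (y s)\<bar> / (u ^ N * (1 - s) ^ (2 * N))"
      using pos by (simp add: pos_le_divide_eq)
    also have "\<dots> = \<bar>a\<bar>" using u that by (simp add: a_def abs_mult)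
    finally have "2 * u + 1 \<le> \<bar>a\<bar>" .
    moreover have "sgn a = sgn (f - y s)"
      using that u h(2)[of "y s"] by (simp add: a_def sgn_mult sgn_divide)
    ultimately show ?thesis unfolding a_def[symmetric] using u
      by (cases "f - y s" "0::real" rule: linorder_cases) (auto simp: clampr_def sgn_if split: if_splits)
  qed
  have "y s - f - u * (1 - s)\<^sup>2 < 0"
  proof (rule negative_invariant[OF _ _ _ s])
    show "((\<lambda>s. y s - f - u * (1 - s)\<^sup>2) has_real_derivative
        clampr (2 * u + 1) ((2 * u + 1) / u ^ N * h (y s) / (1 - s) ^ (2 * N)) + 2 * u * (1 - s)) (at s within {0..1})"
      if "s \<in> {0..<1}" for s
      using der[OF that] by (auto intro!: derivative_eq_intros simp: algebra_simps)
    show "y 0 - f - u * (1 - 0)\<^sup>2 < 0" using y0 f by simp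
    show "clampr (2 * u + 1) ((2 * u + 1) / u ^ N * h (y s) / (1 - s) ^ (2 * N)) + 2 * u * (1 - s) < 0"
      if "s \<in> {0..<1}" "y s - f - u * (1 - s)\<^sup>2 = 0" for s
    proof -
      have "0 < u * (1 - s)\<^sup>2" using u that by simp
      then have "f - y s < 0" "\<bar>f - y s\<bar> = u * (1 - s)\<^sup>2" using that by linarith+
      moreover have "0 \<le> u * s" using u that by simp
      ultimately show ?thesis using sat[OF that(1)] by (simp add: algebra_simps)
    qed
  qed
  moreover have "f - y s - u * (1 - s)\<^sup>2 < 0"
  proof (rule negative_invariant[OF _ _ _ s])
    show "((\<lambda>s. f - y s - u * (1 - s)\<^sup>2) has_real_derivative
        - clampr (2 * u + 1) ((2 * u + 1) / u ^ N * h (y s) / (1 - s) ^ (2 * N)) + 2 * u * (1 - s)) (at s within {0..1})"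
      if "s \<in> {0..<1}" for s
      using der[OF that] by (auto intro!: derivative_eq_intros simp: algebra_simps)
    show "f - y 0 - u * (1 - 0)\<^sup>2 < 0" using y0 f by simp
    show "- clampr (2 * u + 1) ((2 * u + 1) / u ^ N * h (y s) / (1 - s) ^ (2 * N)) + 2 * u * (1 - s) < 0"
      if "s \<in> {0..<1}" "f - y s - u * (1 - s)\<^sup>2 = 0" for s
    proof -
      have "0 < u * (1 - s)\<^sup>2" using u that by simp
      then have "f - y s > 0" "\<bar>f - y s\<bar> = u * (1 - s)\<^sup>2" using that by linarith+
      moreover have "0 \<le> u * s" using u that by simp
      ultimately show ?thesis using sat[OF that(1)] by (simp add: algebra_simps)
    qed
  qed
  ultimately show ?thesis by linarith
qed

lemma barrier_limit:
  fixes y :: "real \<Rightarrow> real"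
  assumes bar: "\<And>s. s \<in> {0..<1} \<Longrightarrow> \<bar>y s - f\<bar> \<le> u * (1 - s)\<^sup>2"
    and cont: "continuous (at 1 within {0..1}) y"
  shows "y 1 = f"
proof -
  have "(y \<longlongrightarrow> y 1) (at 1 within {0..1})" using cont by (simp add: continuous_within)
  moreover have "(y \<longlongrightarrow> f) (at 1 within {0..1})"
  proof (rule Lim_null_comparison[THEN LIM_zero_cancel])
    show "\<forall>\<^sub>F s in at 1 within {0..1}. norm (y s - f) \<le> u * (1 - s)\<^sup>2"
      unfolding eventually_at by (rule exI[of _ 1]) (use bar in auto)
    have "((\<lambda>s. u * (1 - s)\<^sup>2) \<longlongrightarrow> u * (1 - 1)\<^sup>2) (at 1 within {0..1::real})"
      by (intro tendsto_intros)
    then show "((\<lambda>s. u * (1 - s)\<^sup>2) \<longlongrightarrow> 0) (at 1 within {0..1::real})" by simp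
  qed
  moreover have "at 1 within {0..1::real} \<noteq> bot" by (simp add: at_within_Icc_at_left)
  ultimately show ?thesis using tendsto_unique by blast
qed

text \<open>The quadratic barrier leaves a difference quotient of size at most
  \<open>u * (1 - s)\<close>. This agrees with the value \<open>0\<close> of
  \<open>clamp_sol\<close> at \<open>s = 1\<close>, so the equation holds at the endpoint
  too.\<close>

lemma barrier_derivative_zero:
  fixes y :: "real \<Rightarrow> real"
  assumes bar: "\<And>s. s \<in> {0..<1} \<Longrightarrow> \<bar>y s - f\<bar> \<le> u * (1 - s)\<^sup>2" and "y 1 = f"
  shows "(y has_real_derivative 0) (at 1 within {0..1})"
  unfolding has_field_derivative_iff
proof (rule Lim_null_comparison)
  show "\<forall>\<^sub>F s in at 1 within {0..1}. norm ((y s - y 1) / (s - 1)) \<le> u * (1 - s)"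
  proof (unfold eventually_at, intro exI[of _ 1] conjI ballI impI)
    fix s :: real assume "s \<in> {0..1}" "s \<noteq> 1 \<and> dist s 1 < 1"
    then have s: "s \<in> {0..<1}" by auto
    then have "\<bar>y s - f\<bar> / (1 - s) \<le> u * (1 - s)"
      using bar[OF s] by (simp add: divide_le_eq power2_eq_square mult.assoc)
    moreover have "\<bar>s - 1\<bar> = 1 - s" using s by simp
    ultimately show "norm ((y s - y 1) / (s - 1)) \<le> u * (1 - s)" using assms(2) by (simp add: abs_divide)
  qed simp
  have "((\<lambda>s. u * (1 - s)) \<longlongrightarrow> u * (1 - 1)) (at 1 within {0..1::real})"
    by (intro tendsto_intros)
  then show "((\<lambda>s. u * (1 - s)) \<longlongrightarrow> 0) (at 1 within {0..1::real})" by simp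
qed

lemma isd_lipschitz_on_cball:
  assumes "isd (f :: 'a::euclidean_space \<Rightarrow> real)"
  shows "\<exists>L\<ge>0. \<forall>x\<in>cball 0 R. \<forall>y\<in>cball 0 R. \<bar>f x - f y\<bar> \<le> L * norm (x - y)"
  using assms
proof induction
  case (isd_poly p)
  then show ?case
  proof induction
    case (pf_const c)
    show ?case by (rule exI[of _ 0]) simp
  next
    case (pf_coord b)
    have "\<bar>x \<bullet> b - y \<bullet> b\<bar> \<le> 1 * norm (x - y)" for x y
      using Basis_le_norm[OF pf_coord, of "x - y"] by (simp add: inner_diff_left)
    then show ?case by (intro exI[of _ 1]) simp
  next
    case (pf_add p q)
    then obtain L L' where L: "0 \<le> L" "0 \<le> L'"
      "\<And>x y. x \<in> cball 0 R \<Longrightarrow> y \<in> cball 0 R \<Longrightarrow> \<bar>p x - p y\<bar> \<le> L * norm (x - y)"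
      "\<And>x y. x \<in> cball 0 R \<Longrightarrow> y \<in> cball 0 R \<Longrightarrow> \<bar>q x - q y\<bar> \<le> L' * norm (x - y)" by blast
    have "\<bar>p x + q x - (p y + q y)\<bar> \<le> (L + L') * norm (x - y)"
      if "x \<in> cball 0 R" "y \<in> cball 0 R" for x y
      using L(3,4)[OF that] by (simp add: distrib_right)
    then show ?case using L(1,2) by (intro exI[of _ "L + L'"]) auto
  next
    case (pf_mult p q)
    then obtain L L' where L: "0 \<le> L" "0 \<le> L'"
      "\<And>x y. x \<in> cball 0 R \<Longrightarrow> y \<in> cball 0 R \<Longrightarrow> \<bar>p x - p y\<bar> \<le> L * norm (x - y)"
      "\<And>x y. x \<in> cball 0 R \<Longrightarrow> y \<in> cball 0 R \<Longrightarrow> \<bar>q x - q y\<bar> \<le> L' * norm (x - y)" by blast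
    have "bounded (r ` cball 0 R)" if "poly_fun r" for r :: "'a \<Rightarrow> real"
      using continuous_on_subset[OF poly_fun_continuous[OF that]]
      by (intro compact_imp_bounded compact_continuous_image) auto
    then obtain B B' where B: "\<And>x. x \<in> cball 0 R \<Longrightarrow> \<bar>p x\<bar> \<le> B" "\<And>x. x \<in> cball 0 R \<Longrightarrow> \<bar>q x\<bar> \<le> B'"
      "0 < B" "0 < B'"
      using pf_mult.hyps unfolding bounded_pos by (metis imageI real_norm_def)
    have "\<bar>p x * q x - p y * q y\<bar> \<le> (B * L' + B' * L) * norm (x - y)"
      if x: "x \<in> cball 0 R" "y \<in> cball 0 R" for x y
    proof -
      have "p x * q x - p y * q y = p x * (q x - q y) + q y * (p x - p y)" by (simp add: algebra_simps)
      also have "\<bar>\<dots>\<bar> \<le> \<bar>p x\<bar> * \<bar>q x - q y\<bar> + \<bar>q y\<bar> * \<bar>p x - p y\<bar>"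
        using abs_triangle_ineq by (metis abs_mult)
      also have "\<dots> \<le> B * (L' * norm (x - y)) + B' * (L * norm (x - y))"
        using B(1)[OF x(1)] B(2)[OF x(2)] B(3,4) L(3,4)[OF x] by (intro add_mono mult_mono) auto
      finally show ?thesis by (simp add: algebra_simps)
    qed
    then show ?case using L(1,2) B(3,4) by (intro exI[of _ "B * L' + B' * L"]) auto
  qed
next
  case (isd_min f g)
  then obtain L L' where L: "0 \<le> L" "0 \<le> L'"
    "\<And>x y. x \<in> cball 0 R \<Longrightarrow> y \<in> cball 0 R \<Longrightarrow> \<bar>f x - f y\<bar> \<le> L * norm (x - y)"
    "\<And>x y. x \<in> cball 0 R \<Longrightarrow> y \<in> cball 0 R \<Longrightarrow> \<bar>g x - g y\<bar> \<le> L' * norm (x - y)" by blast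
  have "\<bar>min (f x) (g x) - min (f y) (g y)\<bar> \<le> (L + L') * norm (x - y)"
    if "x \<in> cball 0 R" "y \<in> cball 0 R" for x y
  proof -
    have "\<bar>min (f x) (g x) - min (f y) (g y)\<bar> \<le> \<bar>f x - f y\<bar> + \<bar>g x - g y\<bar>" by linarith
    then show ?thesis using L(3,4)[OF that] by (simp add: distrib_right)
  qed
  then show ?case using L(1,2) by (intro exI[of _ "L + L'"]) auto
next
  case (isd_max f g)
  then obtain L L' where L: "0 \<le> L" "0 \<le> L'"
    "\<And>x y. x \<in> cball 0 R \<Longrightarrow> y \<in> cball 0 R \<Longrightarrow> \<bar>f x - f y\<bar> \<le> L * norm (x - y)"
    "\<And>x y. x \<in> cball 0 R \<Longrightarrow> y \<in> cball 0 R \<Longrightarrow> \<bar>g x - g y\<bar> \<le> L' * norm (x - y)" by blast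
  have "\<bar>max (f x) (g x) - max (f y) (g y)\<bar> \<le> (L + L') * norm (x - y)"
    if "x \<in> cball 0 R" "y \<in> cball 0 R" for x y
  proof -
    have "\<bar>max (f x) (g x) - max (f y) (g y)\<bar> \<le> \<bar>f x - f y\<bar> + \<bar>g x - g y\<bar>" by linarith
    then show ?thesis using L(3,4)[OF that] by (simp add: distrib_right)
  qed
  then show ?case using L(1,2) by (intro exI[of _ "L + L'"]) auto
qed

section \<open>The network\<close>

definition diag_matrix :: "('d \<Rightarrow> real) \<Rightarrow> real^'d^'d::finite" where
  "diag_matrix d = (\<chi> i j. if i = j then d i else 0)"

lemma diag_matrix_mult_vec: "diag_matrix d *v v = (\<chi> i. d i * v $ i)"
  by (simp add: diag_matrix_def matrix_vector_mult_def vec_eq_iff if_distrib[of "\<lambda>x. x * _"] cong: if_cong)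

lemma diag_matrix_mult: "diag_matrix d ** diag_matrix e = diag_matrix (\<lambda>i. d i * e i)"
  by (simp add: diag_matrix_def matrix_matrix_mult_def vec_eq_iff if_distrib[of "\<lambda>x. x * _"] cong: if_cong)

lemma diag_matrix_1: "diag_matrix (\<lambda>i. 1) = mat 1"
  by (simp add: diag_matrix_def mat_def)

lemma matrix_inv_mult_cancel:
  fixes A :: "real^'d^'d::finite"
  assumes "invertible A"
  shows "matrix_inv A *v (A *v v) = v"
proof -
  have "A ** matrix_inv A = mat 1 \<and> matrix_inv A ** A = mat 1"
    unfolding matrix_inv_def by (rule someI_ex) (use assms in \<open>simp add: invertible_def\<close>)
  then show ?thesis by (simp add: matrix_vector_mul_assoc)
qed

lemma clamp_sol_diag:
  assumes "\<And>i. d i \<noteq> 0"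
  shows "clamp_sol c (diag_matrix d) b = (\<chi> i. clampr c (b $ i / d i))"
proof -
  have inv: "invertible (diag_matrix d)"
    unfolding invertible_def
    by (rule exI[of _ "diag_matrix (\<lambda>i. 1 / d i)"]) (simp add: diag_matrix_mult assms diag_matrix_1)
  have "matrix_inv (diag_matrix d) *v (diag_matrix d *v (\<chi> i. b $ i / d i)) = (\<chi> i. b $ i / d i)"
    using inv by (rule matrix_inv_mult_cancel)
  moreover have "diag_matrix d *v (\<chi> i. b $ i / d i) = b"
    by (simp add: diag_matrix_mult_vec vec_eq_iff assms)
  ultimately have "matrix_inv (diag_matrix d) *v b = (\<chi> i. b $ i / d i)" by simp
  then show ?thesis using inv by (simp add: clamp_sol_def clamp_def clampr_def)
qed

lemma clamp_sol_diag_singular: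
  assumes "d i = 0"
  shows "clamp_sol c (diag_matrix d) b = 0"
proof -
  have "\<not> invertible (diag_matrix d)"
  proof
    assume "invertible (diag_matrix d)"
    from matrix_inv_mult_cancel[OF this, of "axis i 1"]
    have "matrix_inv (diag_matrix d) *v (diag_matrix d *v axis i 1) = axis i 1" .
    moreover have "diag_matrix d *v axis i 1 = 0"
      using assms by (auto simp: diag_matrix_mult_vec vec_eq_iff axis_def)
    ultimately have "axis i (1::real) = 0" by simp
    then show False by (simp add: axis_eq_0_iff)
  qed
  then show ?thesis by (simp add: clamp_sol_def)
qed

lemma has_vector_derivative_vec_iff:
  fixes z :: "real \<Rightarrow> real^'d::finite"
  shows "(z has_vector_derivative v) (at s within S) \<longleftrightarrow>
    (\<forall>i. ((\<lambda>s. z s $ i) has_real_derivative v $ i) (at s within S))"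
  unfolding has_vector_derivative_def has_derivative_componentwise_within[of z]
  by (auto simp: Basis_vec_def inner_axis has_field_derivative_def mult_commute_abs)

text \<open>An auxiliary point of the graph over \<open>x\<close> is added as a third variable, its
  coordinate \<open>i\<close> is compared with \<open>y\<close>, and the point is projected
  away.\<close>

lemma semialgebraic_fun_component:
  fixes F :: "'a::euclidean_space \<Rightarrow> real^'n"
  assumes "semialgebraic_fun F"
  shows "semialgebraic {(x, y). y < F x $ i}" "semialgebraic {(x, y). F x $ i < y}"
proof -
  have "semialgebraic {(z :: ('a \<times> real) \<times> (real^'n)). (fst (fst z), snd z) \<in> {(x, F x) | x. True}}" (is "semialgebraic ?G")
    using assms unfolding semialgebraic_fun_def
    by (rule semialgebraic_vimage_linear) (auto intro!: linearI)
  moreover have nth: "poly_fun (\<lambda>z :: ('a \<times> real) \<times> (real^'n). snd z $ i)"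
    by (intro poly_fun_linear linearI) auto
  moreover have y: "poly_fun (\<lambda>z :: ('a \<times> real) \<times> (real^'n). snd (fst z))"
    by (intro poly_fun_linear linearI) auto
  ultimately have "semialgebraic (?G \<inter> {z. 0 < snd z $ i - snd (fst z)})"
    and "semialgebraic (?G \<inter> {z. 0 < snd (fst z) - snd z $ i})"
    using semialgebraic_Int[OF _ sa_pos[OF poly_fun_diff]] by blast+
  from this[THEN semialgebraic_projection]
  have "semialgebraic {z. \<exists>y. (z, y) \<in> ?G \<inter> {z. 0 < snd z $ i - snd (fst z)}}"
    "semialgebraic {z. \<exists>y. (z, y) \<in> ?G \<inter> {z. 0 < snd (fst z) - snd z $ i}}" .
  moreover have "{z. \<exists>y. (z, y) \<in> ?G \<inter> {z. 0 < snd z $ i - snd (fst z)}} = {(x, y). y < F x $ i}"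
    "{z. \<exists>y. (z, y) \<in> ?G \<inter> {z. 0 < snd (fst z) - snd z $ i}} = {(x, y). F x $ i < y}"
    by auto
  ultimately show "semialgebraic {(x, y). y < F x $ i}" "semialgebraic {(x, y). F x $ i < y}"
    by simp_all
qed

theorem mainTheorem5:
  fixes F :: "real^'m \<Rightarrow> real^'n" and u :: real
  assumes "u > 0"
    and "\<forall>x. \<forall>i. - u < F x $ i \<and> F x $ i < u"
    and "continuous_on UNIV F"
    and "semialgebraic_fun F"
  shows "\<exists>(M :: real^'m \<Rightarrow> real^('n + unit) \<Rightarrow> real \<Rightarrow> real^('n + unit)^('n + unit))
           (b :: real^'m \<Rightarrow> real^('n + unit) \<Rightarrow> real \<Rightarrow> real^('n + unit)) (c :: real).
           isd_net M b \<and> c > 0 \<and>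
           (\<forall>x. (\<exists>z. sann_solution M b x c z) \<and>
                (\<forall>z. sann_solution M b x c z \<longrightarrow> first_comps (z 1) = F x))"
proof -
  have Fu: "\<bar>F x $ i\<bar> < u" for x i using assms(2)[rule_format, of x i] by linarith
  have "\<exists>N H. odd N \<and> isd H \<and> (\<forall>x y. \<bar>F x $ i - y\<bar> ^ N \<le> \<bar>H (x, y)\<bar> \<and> sgn (H (x, y)) = sgn (F x $ i - y))" for i
    using assms(3) Fu semialgebraic_fun_component[OF assms(4)]
    by (intro isd_restoring_field) (auto intro: continuous_on_component)
  then obtain N H where N: "\<And>i. odd (N i)" and H: "\<And>i. isd (H i)"
    "\<And>i x y. \<bar>F x $ i - y\<bar> ^ N i \<le> \<bar>H i (x, y)\<bar>" "\<And>i x y. sgn (H i (x, y)) = sgn (F x $ i - y)"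
    by metis
  define c where "c = 2 * u + 1"
  \<comment> \<open>The extra component has diagonal entry \<open>1\<close> and right-hand side
    \<open>0\<close>, so it never affects invertibility and its velocity is
    \<open>0\<close>.\<close>
  define d :: "real \<Rightarrow> 'n + unit \<Rightarrow> real" where
    "d s a = (case a of Inl i \<Rightarrow> (1 - s) ^ (2 * N i) | Inr _ \<Rightarrow> 1)" for s a
  define M :: "real^'m \<Rightarrow> real^('n + unit) \<Rightarrow> real \<Rightarrow> real^('n + unit)^('n + unit)" where
    "M x z s = diag_matrix (d s)" for x z s
  define b :: "real^'m \<Rightarrow> real^('n + unit) \<Rightarrow> real \<Rightarrow> real^('n + unit)" where
    "b x z s = (\<chi> a. case a of Inl i \<Rightarrow> c / u ^ N i * H i (x, z $ Inl i) | Inr _ \<Rightarrow> 0)" for x z s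
  have c0: "0 < c" using assms(1) by (simp add: c_def)
  have "isd_net M b"
    unfolding isd_net_def
  proof (intro conjI allI)
    show "isd (\<lambda>(x, z, s). M x z s $ i $ j)" for i j
    proof (rule isd_poly)
      have "poly_fun (\<lambda>p :: (real^'m) \<times> (real^('n + unit)) \<times> real. snd (snd p))"
        by (intro poly_fun_linear linearI) auto
      then have "poly_fun (\<lambda>p :: (real^'m) \<times> (real^('n + unit)) \<times> real. d (snd (snd p)) i)"
        unfolding d_def by (cases i) (auto intro!: poly_fun_power poly_fun_diff pf_const)
      then show "poly_fun (\<lambda>(x, z, s). M x z s $ i $ j)"
        unfolding M_def diag_matrix_def by (cases "i = j") (auto simp: case_prod_unfold intro: pf_const)
    qed
    show "isd (\<lambda>(x, z, s). b x z s $ a)" for a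
    proof (cases a)
      case (Inl i)
      have "linear (\<lambda>p :: (real^'m) \<times> (real^('n + unit)) \<times> real. (fst p, fst (snd p) $ Inl i))"
        by (auto intro!: linearI)
      then have "isd (\<lambda>p :: (real^'m) \<times> (real^('n + unit)) \<times> real. H i (fst p, fst (snd p) $ Inl i))"
        by (rule isd_compose_linear[OF H(1)])
      then have "isd (\<lambda>p :: (real^'m) \<times> (real^('n + unit)) \<times> real. c / u ^ N i * H i (fst p, fst (snd p) $ Inl i))"
        by (rule isd_mult_poly) (use c0 assms(1) in \<open>auto intro: pf_const\<close>)
      then show ?thesis by (simp add: b_def Inl case_prod_unfold)
    next
      case (Inr i)
      then show ?thesis by (simp add: b_def case_prod_unfold isd_poly pf_const)
    qed
  qed
  define D where "D x i y s = clampr c (c / u ^ N i * H i (x, y) / (1 - s) ^ (2 * N i))" for x i y s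
  have rhs: "clamp_sol c (M x z s) (b x z s) = (\<chi> a. case a of Inl i \<Rightarrow> D x i (z $ Inl i) s | Inr _ \<Rightarrow> 0)"
    if "s < 1" for x z s
  proof -
    have "d s a \<noteq> 0" for a using that by (cases a) (auto simp: d_def)
    then have "clamp_sol c (M x z s) (b x z s) = (\<chi> a. clampr c (b x z s $ a / d s a))"
      unfolding M_def by (rule clamp_sol_diag)
    also have "\<dots> = (\<chi> a. case a of Inl i \<Rightarrow> D x i (z $ Inl i) s | Inr _ \<Rightarrow> 0)"
      using c0 by (auto simp: vec_eq_iff b_def d_def D_def clampr_def split: sum.split)
    finally show ?thesis .
  qed
  have rhs1: "clamp_sol c (M x z 1) (b x z 1) = 0" for x z
  proof -
    \<comment> \<open>Index types are nonempty, so some component \<open>Inl undefined\<close>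
      exists; its exponent is nonzero because \<open>N\<close> is odd, and its diagonal entry
      vanishes at \<open>s = 1\<close>.\<close>
    have "N undefined \<noteq> 0" using N[of undefined] by (metis even_zero)
    then have "d 1 (Inl undefined) = 0" by (simp add: d_def)
    then show ?thesis unfolding M_def by (rule clamp_sol_diag_singular)
  qed
  have barrier: "\<bar>y s - F x $ i\<bar> \<le> u * (1 - s)\<^sup>2"
    if "y 0 = 0" "\<And>s. s \<in> {0..<1} \<Longrightarrow> (y has_real_derivative D x i (y s) s) (at s within {0..1})" "s \<in> {0..<1}"
    for y x i s
    using Fu H(2,3) that(1) that(2)[unfolded D_def c_def] that(3)
    by (rule clamped_ode_barrier[where h = "\<lambda>y. H i (x, y)"])
  have exact: "first_comps (z 1) = F x" if z: "sann_solution M b x c z" for x z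
  proof -
    have "z 1 $ Inl i = F x $ i" for i
    proof (rule barrier_limit)
      have z0: "z 0 $ Inl i = 0" using z by (simp add: sann_solution_def)
      have der: "((\<lambda>s. z s $ Inl i) has_real_derivative
          clamp_sol c (M x (z s) s) (b x (z s) s) $ Inl i) (at s within {0..1})" if "s \<in> {0..1}" for s
        using z that unfolding sann_solution_def has_vector_derivative_vec_iff by blast
      then have "((\<lambda>s. z s $ Inl i) has_real_derivative D x i (z s $ Inl i) s) (at s within {0..1})"
        if "s \<in> {0..<1}" for s
        using that rhs[of s x "z s"] der[of s] by simp
      then show "\<bar>z s $ Inl i - F x $ i\<bar> \<le> u * (1 - s)\<^sup>2" if "s \<in> {0..<1}" for s
        using that z0 by (intro barrier)
      show "continuous (at 1 within {0..1}) (\<lambda>s. z s $ Inl i)"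
        using der[of 1] by (intro DERIV_continuous) auto
    qed
    then show ?thesis by (simp add: first_comps_def vec_eq_iff)
  qed
  have exists: "\<exists>z. sann_solution M b x c z" for x
  proof -
    have "\<exists>y. y 0 = 0 \<and> (\<forall>s\<in>{0..<1}. (y has_real_derivative D x i (y s) s) (at s within {0..1}))" for i
    proof -
      define R where "R = norm x + c"
      obtain L where L: "0 \<le> L" "\<And>p q. p \<in> cball 0 R \<Longrightarrow> q \<in> cball 0 R \<Longrightarrow> \<bar>H i p - H i q\<bar> \<le> L * norm (p - q)"
        using isd_lipschitz_on_cball[OF H(1)[of i], of R] by blast
      have "\<bar>c / u ^ N i * H i (x, a) - c / u ^ N i * H i (x, a')\<bar> \<le> c / u ^ N i * L * \<bar>a - a'\<bar>"
        if "\<bar>a\<bar> \<le> c" "\<bar>a'\<bar> \<le> c" for a a'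
      proof -
        have "(x, t) \<in> cball 0 R" if "\<bar>t\<bar> \<le> c" for t
          using norm_Pair_le[of x t] that by (simp add: R_def)
        then have "\<bar>H i (x, a) - H i (x, a')\<bar> \<le> L * norm ((x, a) - (x, a'))" using that by (intro L(2))
        then have "\<bar>H i (x, a) - H i (x, a')\<bar> \<le> L * \<bar>a - a'\<bar>" by (simp add: norm_Pair)
        then have "c / u ^ N i * \<bar>H i (x, a) - H i (x, a')\<bar> \<le> c / u ^ N i * (L * \<bar>a - a'\<bar>)"
          using c0 assms(1) by (intro mult_left_mono) auto
        moreover have "\<bar>k * p - k * q\<bar> = k * \<bar>p - q\<bar>" if "0 < k" for k p q :: real
          using that by (simp add: abs_mult flip: right_diff_distrib)
        moreover have "0 < c / u ^ N i" using c0 assms(1) by simp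
        ultimately show ?thesis by (simp only: mult.assoc)
      qed
      moreover have "0 \<le> c / u ^ N i * L" using c0 assms(1) L(1) by simp
      \<comment> \<open>\<open>clamped_ode_solution\<close> is used with
        \<open>m = 2 * N i - 1\<close>, because the exponent in its denominator is
        \<open>Suc m\<close>.\<close>
      moreover have "0 < 2 * N i - 1" using N[of i] by (cases "N i") auto
      ultimately have "\<exists>y. y 0 = 0 \<and> (\<forall>s\<in>{0..<1}.
        (y has_real_derivative clampr c (c / u ^ N i * H i (x, y s) / (1 - s) ^ Suc (2 * N i - 1))) (at s within {0..1}))"
        using c0 by (intro clamped_ode_solution) auto
      moreover have "Suc (2 * N i - 1) = 2 * N i" using \<open>0 < 2 * N i - 1\<close> by simp
      ultimately show ?thesis unfolding D_def by simp
    qed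
    then obtain y where y: "\<And>i. y i 0 = 0"
      "\<And>i s. s \<in> {0..<1} \<Longrightarrow> (y i has_real_derivative D x i (y i s) s) (at s within {0..1})"
      by metis
    \<comment> \<open>The solution \<open>y i\<close> is controlled only before time
      \<open>1\<close>. Its value at \<open>1\<close> is reset to the limit forced by the barrier,
      which makes it differentiable there as well.\<close>
    define w where "w i s = (if s < 1 then y i s else F x $ i)" for i and s :: real
    have w: "(w i has_real_derivative D x i (w i s) s) (at s within {0..1})" if "s \<in> {0..<1}" for i s
    proof -
      have "(w i has_real_derivative D x i (y i s) s) (at s within {0..1})"
        by (rule has_field_derivative_transform_within[OF y(2)[OF that], of "1 - s"])
          (use that in \<open>auto simp: w_def dist_real_def\<close>)
      then show ?thesis using that by (simp add: w_def)
    qed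
    have w1: "(w i has_real_derivative 0) (at 1 within {0..1})" for i
    proof (rule barrier_derivative_zero)
      show "\<bar>w i s - F x $ i\<bar> \<le> u * (1 - s)\<^sup>2" if "s \<in> {0..<1}" for s
      proof (rule barrier)
        show "w i 0 = 0" using y(1) by (simp add: w_def)
      qed (fact w that)+
    qed (simp add: w_def)
    define z :: "real \<Rightarrow> real^('n + unit)" where
      "z s = (\<chi> a. case a of Inl i \<Rightarrow> w i s | Inr _ \<Rightarrow> 0)" for s
    have "(z has_vector_derivative clamp_sol c (M x (z s) s) (b x (z s) s)) (at s within {0..1})"
      if s: "s \<in> {0..1}" for s
      unfolding has_vector_derivative_vec_iff
    proof
      fix a
      show "((\<lambda>s. z s $ a) has_real_derivative clamp_sol c (M x (z s) s) (b x (z s) s) $ a) (at s within {0..1})"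
      proof (cases a)
        case (Inl i)
        then show ?thesis using s w[of s i] w1[of i] rhs[of s x "z s"] rhs1[of x "z s"]
          by (cases "s = 1") (simp_all add: z_def)
      next
        case (Inr i)
        then show ?thesis using s rhs[of s x "z s"] rhs1[of x "z s"]
          by (cases "s = 1") (simp_all add: z_def)
      qed
    qed
    moreover have "z 0 = 0" by (auto simp: z_def w_def y(1) vec_eq_iff split: sum.split)
    ultimately show ?thesis unfolding sann_solution_def by blast
  qed
  show ?thesis using \<open>isd_net M b\<close> c0 exact exists by blast
qed

end
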